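(* Let $\mathcal{H}$ be a stable ordered-union ultrafilter on $\mathrm{FIN}$ and let $\mathbb{P}(\mathcal{H})$ be the associated partial order of $\mathcal{H}$-conditions. Suppose $\mathbb{Q}$ is an $\omega^\omega$-bounding forcing. If $\mathbb{P}(\mathcal{H})$ completely embeds into $\mathbb{Q}$, then $$\Vdash_{\mathbb{Q}}\ \text{``there is no stable ordered-union ultrafilter on } \mathrm{FIN} \text{ extending } \mathcal{H}\text{''}.$$
   Context: $\omega=\{0,1,2,\dots\}$ and each $n\in\omega$ is identified with $\{0,\dots,n-1\}$. $\mathrm{FIN}$ is the set of non-empty finite subsets of $\omega$. For $s,t\in\mathrm{FIN}$, $s<_{\mathtt{b}}t$ means $\max(s)<\min(t)$. A block sequence is a non-empty $X\subseteq\mathrm{FIN}$ linearly ordered by $<_{\mathtt{b}}$; $X(i)$ is its $i$th member in increasing order (starting from $i=0$). $\mathrm{FIN}^{[\omega]}$ is the set of infinite block sequences. For $A\subseteq\mathrm{FIN}$, $[A]$ is the set of all unions $\bigcup X$ where $X\subseteq A$ is a finite block sequence. An ultrafilter $\mathcal{H}$ on $\mathrm{FIN}$ is an ordered-union ultrafilter if for every $A\in\mathcal{H}$ there is $X\in\mathrm{FIN}^{[\omega]}$ with $[X]\in\mathcal{H}$ and $[X]\subseteq A$. It is stable if for every sequence $\langle X_n:n\in\omega\rangle$ with $X_n\in\mathrm{FIN}^{[\omega]}$ and $[X_n]\in\mathcal{H}$ for all $n$, there is $Y\in\mathrm{FIN}^{[\omega]}$ with $[Y]\in\mathcal{H}$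 such that for every $n$, $Y(i)\in[X_n]$ for all but finitely many $i\in\omega$. Big sets: $\mathcal{P}(l)$ is the power set of $l$, $2^{\mathcal{P}(l)}$ the set of functions $\mathcal{P}(l)\to 2$, and $s^-=s\setminus\{\max(s)\}$ for $s\in\mathrm{FIN}$. For $k\leq l<\omega$ and $s\in\mathrm{FIN}$ with $\max(s)=l$, a set $A\subseteq 2^{\mathcal{P}(l)}$ is $\langle k,s\rangle$-big if for every $\sigma:\mathcal{P}(k)\to 2$ there is $\tau\in A$ such that $\sigma(u)=\tau(u\cup s^-)$ for all $u\in\mathcal{P}(k)$. Trees: $\mathbb{T}=\bigcup_{l\in\omega}\prod_{k\in l}2^{\mathcal{P}(k)}$. A subtree of $\mathbb{T}$ is a subset $T\subseteq\mathbb{T}$ closed under restriction to initial segments. $\mathrm{Lev}_n(T)=\{f\in T:\operatorname{dom}(f)=n\}$ and $\operatorname{succ}_T(f)=\{\sigma: f^\frown\langle\sigma\rangle\in T\}$. The forcing: an $\mathcal{H}$-condition is a subtree $p=T_p\subseteq\mathbb{T}$ such that (1) $\emptyset\in T_p$; (2) for all $f\in T_p$ and $\operatorname{dom}(f)\leq n<\omega$ there is $g\in T_p$ with $f\subseteq g$ and $n\leq\operatorname{dom}(g)$; (3) for each $k\in\omega$, $H_{p,k}\in\mathcal{H}$, where $H_{p,k}=\{s\in\mathrm{FIN}: k\leq\max(s)\text{ and for all }f\in\mathrm{Lev}_{\max(s)}(T_p),\ \operatorname{succ}_{T_p}(f)\text{ is }\langle k,s\rangle\text{-big}\}$. $\mathbb{P}(\mathcal{H})$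 is the set of $\mathcal{H}$-conditions, ordered by $q\leq p$ iff $T_q\subseteq T_p$. A forcing is $\omega^\omega$-bounding if every function $\omega\to\omega$ in the generic extension is pointwise bounded by a function $\omega\to\omega$ in the ground model. *)

theory Defs
  imports Main "HOL-Library.FuncSet" "HOL-Library.Sublist"
begin

section \<open>Block sequences and ordered-union ultrafilters\<close>

definition FIN :: "nat set set" where
  "FIN = {s. finite s \<and> s \<noteq> {}}"

definition blk_less :: "nat set \<Rightarrow> nat set \<Rightarrow> bool"  (infix \<open><\<^sub>b\<close> 50) where
  "s <\<^sub>b t \<longleftrightarrow> Max s < Min t"

definition block_seq :: "nat set set \<Rightarrow> bool" where
  "block_seq X \<longleftrightarrow> X \<noteq> {} \<and> X \<subseteq> FIN \<and> (\<forall>s\<in>X. \<forall>t\<in>X. s = t \<or> s <\<^sub>b t \<or> t <\<^sub>b s)"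

definition FIN_omega :: "nat set set set" where
  "FIN_omega = {X. block_seq X \<and> infinite X}"

definition block_nth :: "nat set set \<Rightarrow> nat \<Rightarrow> nat set" where
  "block_nth X i = (THE s. s \<in> X \<and> card {t \<in> X. t <\<^sub>b s} = i)"

definition FU :: "nat set set \<Rightarrow> nat set set" where
  "FU A = {\<Union>X | X. X \<subseteq> A \<and> finite X \<and> block_seq X}"

definition ultrafilter_on :: "'a set \<Rightarrow> 'a set set \<Rightarrow> bool" where
  "ultrafilter_on S U \<longleftrightarrow>
     U \<subseteq> Pow S \<and> S \<in> U \<and> {} \<notin> U \<and>
     (\<forall>A\<in>U. \<forall>B\<in>U. A \<inter> B \<in> U) \<and>
     (\<forall>A\<in>U. \<forall>B. A \<subseteq> B \<and> B \<subseteq> S \<longrightarrow> B \<in> U) \<and>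
     (\<forall>A. A \<subseteq> S \<longrightarrow> A \<in> U \<or> S - A \<in> U)"

definition ordered_union :: "nat set set set \<Rightarrow> bool" where
  "ordered_union U \<longleftrightarrow> (\<forall>A\<in>U. \<exists>X\<in>FIN_omega. FU X \<in> U \<and> FU X \<subseteq> A)"

definition stable :: "nat set set set \<Rightarrow> bool" where
  "stable U \<longleftrightarrow>
     (\<forall>X :: nat \<Rightarrow> nat set set. (\<forall>n. X n \<in> FIN_omega \<and> FU (X n) \<in> U) \<longrightarrow>
        (\<exists>Y\<in>FIN_omega. FU Y \<in> U \<and> (\<forall>n. \<exists>m. \<forall>i\<ge>m. block_nth Y i \<in> FU (X n))))"

definition stable_ordered_union_ultrafilter :: "nat set set set \<Rightarrow> bool" where
  "stable_ordered_union_ultrafilter U \<longleftrightarrow>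
     ultrafilter_on FIN U \<and> ordered_union U \<and> stable U"

section \<open>The partial order of \<open>\<H>\<close>-conditions\<close>

text \<open>\<open>cube l\<close> is \<open>2\<close> to the power \<open>\<P>(l)\<close>, with \<open>bool\<close> for \<open>2\<close> and functions extensional
  (undefined outside \<open>\<P>(l)\<close>).\<close>

definition cube :: "nat \<Rightarrow> (nat set \<Rightarrow> bool) set" where
  "cube l = (Pow {..<l} \<rightarrow>\<^sub>E UNIV)"

definition big :: "nat \<Rightarrow> nat set \<Rightarrow> (nat set \<Rightarrow> bool) set \<Rightarrow> bool" where
  "big k s A \<longleftrightarrow>
     (\<forall>\<sigma>\<in>cube k. \<exists>\<tau>\<in>A. \<forall>u\<in>Pow {..<k}. \<sigma> u = \<tau> (u \<union> (s - {Max s})))"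

text \<open>A member of \<open>\<T>\<close> with domain \<open>l\<close> is represented by the list of its \<open>l\<close> values.\<close>

definition TT :: "(nat set \<Rightarrow> bool) list set" where
  "TT = {f. \<forall>k<length f. f ! k \<in> cube k}"

definition subtree :: "(nat set \<Rightarrow> bool) list set \<Rightarrow> bool" where
  "subtree T \<longleftrightarrow> T \<subseteq> TT \<and> (\<forall>f\<in>T. \<forall>g. prefix g f \<longrightarrow> g \<in> T)"

definition Lev :: "nat \<Rightarrow> 'a list set \<Rightarrow> 'a list set" where
  "Lev n T = {f \<in> T. length f = n}"

definition succs :: "'a list set \<Rightarrow> 'a list \<Rightarrow> 'a set" where
  "succs T f = {\<sigma>. f @ [\<sigma>] \<in> T}"

definition big_heights :: "(nat set \<Rightarrow> bool) list set \<Rightarrow> nat \<Rightarrow> nat set set" where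
  "big_heights T k =
     {s \<in> FIN. k \<le> Max s \<and> (\<forall>f\<in>Lev (Max s) T. big k s (succs T f))}"

definition H_conditions :: "nat set set set \<Rightarrow> (nat set \<Rightarrow> bool) list set set" where
  "H_conditions H =
     {T. subtree T \<and> [] \<in> T \<and>
         (\<forall>f\<in>T. \<forall>n\<ge>length f. \<exists>g\<in>T. prefix f g \<and> n \<le> length g) \<and>
         (\<forall>k. big_heights T k \<in> H)}"

section \<open>Forcing notions\<close>

text \<open>A forcing notion is given by its order relation \<open>Q\<close>, where \<open>(q, p) \<in> Q\<close> means
  \<open>q \<le> p\<close> (\<open>q\<close> is stronger); its set of conditions is \<open>Field Q\<close>.\<close>

definition forcing_notion :: "'q rel \<Rightarrow> bool" where
  "forcing_notion Q \<longleftrightarrow> Preorder Q \<and> Field Q \<noteq> {}"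

definition PH :: "nat set set set \<Rightarrow> (nat set \<Rightarrow> bool) list set rel" where
  "PH H = {(q, p). q \<in> H_conditions H \<and> p \<in> H_conditions H \<and> q \<subseteq> p}"

definition compatible :: "'q rel \<Rightarrow> 'q \<Rightarrow> 'q \<Rightarrow> bool" where
  "compatible Q p q \<longleftrightarrow> (\<exists>r. (r, p) \<in> Q \<and> (r, q) \<in> Q)"

definition complete_embedding :: "'p rel \<Rightarrow> 'q rel \<Rightarrow> ('p \<Rightarrow> 'q) \<Rightarrow> bool" where
  "complete_embedding P Q e \<longleftrightarrow>
     e ` Field P \<subseteq> Field Q \<and>
     (\<forall>p p'. (p', p) \<in> P \<longrightarrow> (e p', e p) \<in> Q) \<and>
     (\<forall>p\<in>Field P. \<forall>p'\<in>Field P. compatible P p p' \<longleftrightarrow> compatible Q (e p) (e p')) \<and>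
     (\<forall>q\<in>Field Q. \<exists>p\<in>Field P. \<forall>p'. (p', p) \<in> P \<longrightarrow> compatible Q (e p') q)"

definition completely_embeds :: "'p rel \<Rightarrow> 'q rel \<Rightarrow> bool" where
  "completely_embeds P Q \<longleftrightarrow> (\<exists>e. complete_embedding P Q e)"

section \<open>The forcing relation\<close>

text \<open>Forcing statements are interpreted as predicates on conditions, \<open>\<phi> p\<close> meaning
  that \<open>p\<close> forces \<open>\<phi>\<close>, by the usual recursion on formulas with \<open>\<not>\<close>, \<open>\<and>\<close>, \<open>\<forall>\<close>
  primitive. Three kinds of names occur. Elements of a ground model set are denoted by
  their check names, which are identified with the elements. A name for a subset of a
  ground model set is a set of pairs (element, condition). A name for a family of such
  subsets is a set of pairs (name for a subset, condition). Up to forced equality these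
  are all the names for such objects.

  Quantification over a ground model set \<open>A\<close> in the extension, i.e. over the check name
  of \<open>A\<close>, is \<open>fAll A\<close>; quantification over names is \<open>fAll UNIV\<close>. This applies in
  particular to \<open>\<omega>\<close>, to \<open>FIN\<close>, and to the finite subsets of \<open>FIN\<close>, all of which are
  the same in the extension. Likewise \<open>fGround b\<close> serves for atomic statements on ground
  model objects whose truth value \<open>b\<close> is absolute.\<close>

type_synonym ('a, 'q) set_name = "('a \<times> 'q) set"
type_synonym ('a, 'q) family_name = "(('a, 'q) set_name \<times> 'q) set"

definition fGround :: "bool \<Rightarrow> 'q \<Rightarrow> bool" where
  "fGround b = (\<lambda>p. b)"

definition fAnd :: "('q \<Rightarrow> bool) \<Rightarrow> ('q \<Rightarrow> bool) \<Rightarrow> 'q \<Rightarrow> bool"  (infixr \<open>\<^bold>\<and>\<close> 35) where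
  "(\<phi> \<^bold>\<and> \<psi>) = (\<lambda>p. \<phi> p \<and> \<psi> p)"

definition fAll :: "'x set \<Rightarrow> ('x \<Rightarrow> 'q \<Rightarrow> bool) \<Rightarrow> 'q \<Rightarrow> bool" where
  "fAll A \<phi> = (\<lambda>p. \<forall>x\<in>A. \<phi> x p)"

context
  fixes Q :: "'q rel"
begin

definition fNot :: "('q \<Rightarrow> bool) \<Rightarrow> 'q \<Rightarrow> bool" where
  "fNot \<phi> = (\<lambda>p. \<forall>q. (q, p) \<in> Q \<longrightarrow> \<not> \<phi> q)"

definition fOr :: "('q \<Rightarrow> bool) \<Rightarrow> ('q \<Rightarrow> bool) \<Rightarrow> 'q \<Rightarrow> bool"  (infixr \<open>\<^bold>\<or>\<close> 30) where
  "(\<phi> \<^bold>\<or> \<psi>) = fNot (fNot \<phi> \<^bold>\<and> fNot \<psi>)"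

definition fImp :: "('q \<Rightarrow> bool) \<Rightarrow> ('q \<Rightarrow> bool) \<Rightarrow> 'q \<Rightarrow> bool"  (infixr \<open>\<^bold>\<longrightarrow>\<close> 25) where
  "(\<phi> \<^bold>\<longrightarrow> \<psi>) = fNot (\<phi> \<^bold>\<and> fNot \<psi>)"

definition fEx :: "'x set \<Rightarrow> ('x \<Rightarrow> 'q \<Rightarrow> bool) \<Rightarrow> 'q \<Rightarrow> bool" where
  "fEx A \<phi> = fNot (fAll A (\<lambda>x. fNot (\<phi> x)))"

definition fMem :: "'a \<Rightarrow> ('a, 'q) set_name \<Rightarrow> 'q \<Rightarrow> bool"  (infix \<open>\<^bold>\<in>\<close> 50) where
  "(x \<^bold>\<in> A) = (\<lambda>p. \<forall>p'. (p', p) \<in> Q \<longrightarrow>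
     (\<exists>q r. (q, p') \<in> Q \<and> (x, r) \<in> A \<and> (q, r) \<in> Q))"

definition fSubset :: "('a, 'q) set_name \<Rightarrow> ('a, 'q) set_name \<Rightarrow> 'q \<Rightarrow> bool"
    (infix \<open>\<^bold>\<subseteq>\<close> 50) where
  "(A \<^bold>\<subseteq> B) = fAll UNIV (\<lambda>x. x \<^bold>\<in> A \<^bold>\<longrightarrow> x \<^bold>\<in> B)"

definition fEq :: "('a, 'q) set_name \<Rightarrow> ('a, 'q) set_name \<Rightarrow> 'q \<Rightarrow> bool"
    (infix \<open>\<^bold>=\<close> 50) where
  "(A \<^bold>= B) = (A \<^bold>\<subseteq> B \<^bold>\<and> B \<^bold>\<subseteq> A)"

definition fMemF :: "('a, 'q) set_name \<Rightarrow> ('a, 'q) family_name \<Rightarrow> 'q \<Rightarrow> bool"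
    (infix \<open>\<^bold>\<in>\<^sub>F\<close> 50) where
  "(A \<^bold>\<in>\<^sub>F U) = (\<lambda>p. \<forall>p'. (p', p) \<in> Q \<longrightarrow>
     (\<exists>q B r. (q, p') \<in> Q \<and> (B, r) \<in> U \<and> (q, r) \<in> Q \<and> (A \<^bold>= B) q))"

definition check :: "'a set \<Rightarrow> ('a, 'q) set_name" where
  "check A = A \<times> Field Q"

text \<open>The canonical name for \<open>{x \<in> S. \<phi> x}\<close> as evaluated in the extension.\<close>

definition fCollect :: "'a set \<Rightarrow> ('a \<Rightarrow> 'q \<Rightarrow> bool) \<Rightarrow> ('a, 'q) set_name" where
  "fCollect S \<phi> = {(x, q). x \<in> S \<and> q \<in> Field Q \<and> \<phi> x q}"

definition forced :: "('q \<Rightarrow> bool) \<Rightarrow> bool" where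
  "forced \<phi> \<longleftrightarrow> (\<forall>p\<in>Field Q. \<phi> p)"

subsection \<open>Bounding forcings\<close>

definition fFunction :: "(nat \<times> nat, 'q) set_name \<Rightarrow> 'q \<Rightarrow> bool" where
  "fFunction F =
     (fAll UNIV (\<lambda>n. fEx UNIV (\<lambda>m. (n, m) \<^bold>\<in> F)) \<^bold>\<and>
      fAll UNIV (\<lambda>n. fAll UNIV (\<lambda>m. fAll UNIV (\<lambda>m'.
        (n, m) \<^bold>\<in> F \<^bold>\<and> (n, m') \<^bold>\<in> F \<^bold>\<longrightarrow> fGround (m = m')))))"

definition omega_omega_bounding :: bool where
  "omega_omega_bounding \<longleftrightarrow>
     forced (fAll UNIV (\<lambda>F. fFunction F \<^bold>\<longrightarrow>
       fEx (UNIV :: (nat \<Rightarrow> nat) set) (\<lambda>g.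
         fAll UNIV (\<lambda>n. fAll UNIV (\<lambda>m. (n, m) \<^bold>\<in> F \<^bold>\<longrightarrow> fGround (m \<le> g n))))))"

subsection \<open>Stable ordered-union ultrafilters in the extension\<close>

definition fInfinite :: "('a, 'q) set_name \<Rightarrow> 'q \<Rightarrow> bool" where
  "fInfinite X = fNot (fEx {F. finite F} (\<lambda>F. X \<^bold>= check F))"

definition fBlockSeq :: "(nat set, 'q) set_name \<Rightarrow> 'q \<Rightarrow> bool" where
  "fBlockSeq X =
     (fNot (X \<^bold>= check {}) \<^bold>\<and> X \<^bold>\<subseteq> check FIN \<^bold>\<and>
      fAll FIN (\<lambda>s. fAll FIN (\<lambda>t. s \<^bold>\<in> X \<^bold>\<and> t \<^bold>\<in> X \<^bold>\<longrightarrow>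
        fGround (s = t \<or> s <\<^sub>b t \<or> t <\<^sub>b s))))"

definition fFIN_omega :: "(nat set, 'q) set_name \<Rightarrow> 'q \<Rightarrow> bool" where
  "fFIN_omega X = (fBlockSeq X \<^bold>\<and> fInfinite X)"

text \<open>\<open>fBlockNth X i s\<close> says that \<open>s\<close> is the \<open>i\<close>th member of \<open>X\<close>.\<close>

definition fBlockNth :: "(nat set, 'q) set_name \<Rightarrow> nat \<Rightarrow> nat set \<Rightarrow> 'q \<Rightarrow> bool" where
  "fBlockNth X i s =
     (s \<^bold>\<in> X \<^bold>\<and>
      fEx {F. finite F \<and> card F = i} (\<lambda>F.
        fCollect FIN (\<lambda>t. t \<^bold>\<in> X \<^bold>\<and> fGround (t <\<^sub>b s)) \<^bold>= check F))"

text \<open>A finite block sequence in the extension is a finite subset of \<open>FIN\<close>, hence it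
  lies in the ground model.\<close>

definition fFU :: "(nat set, 'q) set_name \<Rightarrow> (nat set, 'q) set_name" where
  "fFU A = fCollect FIN (\<lambda>s.
     fEx {X. finite X \<and> block_seq X} (\<lambda>X. check X \<^bold>\<subseteq> A \<^bold>\<and> fGround (s = \<Union>X)))"

definition fUltrafilterOn :: "'a set \<Rightarrow> ('a, 'q) family_name \<Rightarrow> 'q \<Rightarrow> bool" where
  "fUltrafilterOn S U =
     (fAll UNIV (\<lambda>A. A \<^bold>\<in>\<^sub>F U \<^bold>\<longrightarrow> A \<^bold>\<subseteq> check S) \<^bold>\<and>
      check S \<^bold>\<in>\<^sub>F U \<^bold>\<and>
      fNot (check {} \<^bold>\<in>\<^sub>F U) \<^bold>\<and>
      fAll UNIV (\<lambda>A. fAll UNIV (\<lambda>B. A \<^bold>\<in>\<^sub>F U \<^bold>\<and> B \<^bold>\<in>\<^sub>F U \<^bold>\<longrightarrow>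
        fCollect S (\<lambda>x. x \<^bold>\<in> A \<^bold>\<and> x \<^bold>\<in> B) \<^bold>\<in>\<^sub>F U)) \<^bold>\<and>
      fAll UNIV (\<lambda>A. fAll UNIV (\<lambda>B. A \<^bold>\<in>\<^sub>F U \<^bold>\<and> A \<^bold>\<subseteq> B \<^bold>\<and> B \<^bold>\<subseteq> check S \<^bold>\<longrightarrow> B \<^bold>\<in>\<^sub>F U)) \<^bold>\<and>
      fAll UNIV (\<lambda>A. A \<^bold>\<subseteq> check S \<^bold>\<longrightarrow>
        A \<^bold>\<in>\<^sub>F U \<^bold>\<or> fCollect S (\<lambda>x. fNot (x \<^bold>\<in> A)) \<^bold>\<in>\<^sub>F U))"

definition fOrderedUnion :: "(nat set, 'q) family_name \<Rightarrow> 'q \<Rightarrow> bool" where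
  "fOrderedUnion U =
     fAll UNIV (\<lambda>A. A \<^bold>\<in>\<^sub>F U \<^bold>\<longrightarrow>
       fEx UNIV (\<lambda>X. fFIN_omega X \<^bold>\<and> fFU X \<^bold>\<in>\<^sub>F U \<^bold>\<and> fFU X \<^bold>\<subseteq> A))"

text \<open>A name for a sequence of subsets of \<open>FIN\<close> is given by a sequence of names for
  subsets of \<open>FIN\<close> (equivalently, by a name for a subset of \<open>\<omega> \<times> FIN\<close>).\<close>

definition fStable :: "(nat set, 'q) family_name \<Rightarrow> 'q \<Rightarrow> bool" where
  "fStable U =
     fAll (UNIV :: (nat \<Rightarrow> (nat set, 'q) set_name) set) (\<lambda>X.
       fAll UNIV (\<lambda>n. fFIN_omega (X n) \<^bold>\<and> fFU (X n) \<^bold>\<in>\<^sub>F U) \<^bold>\<longrightarrow>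
       fEx UNIV (\<lambda>Y. fFIN_omega Y \<^bold>\<and> fFU Y \<^bold>\<in>\<^sub>F U \<^bold>\<and>
         fAll UNIV (\<lambda>n. fEx UNIV (\<lambda>m. fAll {m..} (\<lambda>i.
           fAll FIN (\<lambda>s. fBlockNth Y i s \<^bold>\<longrightarrow> s \<^bold>\<in> fFU (X n)))))))"

definition fStableOrderedUnionUltrafilter :: "(nat set, 'q) family_name \<Rightarrow> 'q \<Rightarrow> bool" where
  "fStableOrderedUnionUltrafilter U =
     (fUltrafilterOn FIN U \<^bold>\<and> fOrderedUnion U \<^bold>\<and> fStable U)"

definition fExtends :: "('a, 'q) family_name \<Rightarrow> 'a set set \<Rightarrow> 'q \<Rightarrow> bool" where
  "fExtends U H = fAll H (\<lambda>A. check A \<^bold>\<in>\<^sub>F U)"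

end

end

theory Submission
  imports Defs
begin

text \<open>The generic branch \<open>x\<close> colours \<open>FIN\<close> by \<open>c(s) = x(max s)(s\<^sup>-)\<close>. An ordered-union ultrafilter in
  the extension contains some \<open>[X]\<close> on which \<open>c\<close> is constant, and by bounding there is a ground
  model \<open>g\<close> such that every interval \<open>[n, g n)\<close> contains a member of \<open>X\<close>. Given a condition \<open>p\<close>,
  choose \<open>Y\<close> in the ground model with \<open>[Y] \<in> \<H>\<close> so sparse that each block \<open>t\<close> of \<open>Y\<close> is preceded
  by a gap \<open>[j, g j)\<close> and the successors of \<open>p\<close> at height \<open>max t\<close> are big enough to be thinned so
  that adding to any \<open>s \<in> [Y]\<close> with last block \<open>t\<close> a non-empty part \<open>u\<close> of this gap changes
  \<open>c(s)\<close>. The thinned tree is still a condition, because this demand leaves the values at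
  \<open>w \<union> t\<^sup>-\<close> with \<open>w \<subseteq> j\<close> free. If the ultrafilter extends \<open>\<H>\<close>, some \<open>s\<close> lies in
  \<open>[X] \<inter> [Y]\<close>; with a member \<open>u\<close> of \<open>X\<close> in the gap below the last block of \<open>s\<close>, also
  \<open>u \<union> s \<in> [X]\<close>, although \<open>c(u \<union> s) \<noteq> c(s)\<close>.\<close>

section \<open>Block sequences\<close>

lemma FIN_iff: "s \<in> FIN \<longleftrightarrow> finite s \<and> s \<noteq> {}"
  by (simp add: FIN_def)

lemma blk_less_iff: "s \<in> FIN \<Longrightarrow> t \<in> FIN \<Longrightarrow> s <\<^sub>b t \<longleftrightarrow> (\<forall>a\<in>s. \<forall>b\<in>t. a < b)"
  by (auto simp add: FIN_def blk_less_def)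

lemma Min_le_Max_FIN: "s \<in> FIN \<Longrightarrow> Min s \<le> Max s"
  by (simp add: FIN_def)

lemma block_seq_subset: "block_seq X \<Longrightarrow> Y \<subseteq> X \<Longrightarrow> Y \<noteq> {} \<Longrightarrow> block_seq Y"
  unfolding block_seq_def by blast

lemma block_seq_FIN: "block_seq X \<Longrightarrow> s \<in> X \<Longrightarrow> s \<in> FIN"
  unfolding block_seq_def by blast

lemma block_seq_cases:
  assumes "block_seq X" "s \<in> X" "t \<in> X"
  obtains "s = t" | "s <\<^sub>b t" | "t <\<^sub>b s"
  using assms unfolding block_seq_def by blast

lemma blk_less_trans: "s \<in> FIN \<Longrightarrow> t \<in> FIN \<Longrightarrow> u \<in> FIN \<Longrightarrow> s <\<^sub>b t \<Longrightarrow> t <\<^sub>b u \<Longrightarrow> s <\<^sub>b u"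
  using Min_le_Max_FIN[of t] by (simp add: blk_less_def)

lemma blk_less_irrefl: "s \<in> FIN \<Longrightarrow> \<not> s <\<^sub>b s"
  using Min_le_Max_FIN[of s] by (simp add: blk_less_def)

lemma inj_on_Min_block_seq: "block_seq X \<Longrightarrow> inj_on Min X"
proof (rule inj_onI)
  fix s t assume X: "block_seq X" "s \<in> X" "t \<in> X" "Min s = Min t"
  have "Min s \<le> Max s" "Min t \<le> Max t"
    using block_seq_FIN[OF X(1)] X(2,3) Min_le_Max_FIN by blast+
  then have "\<not> s <\<^sub>b t" "\<not> t <\<^sub>b s" using X(4) by (auto simp: blk_less_def)
  then show "s = t" using block_seq_cases[OF X(1-3)] by metis
qed

lemma inj_on_Max_block_seq: "block_seq X \<Longrightarrow> inj_on Max X"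
proof (rule inj_onI)
  fix s t assume X: "block_seq X" "s \<in> X" "t \<in> X" "Max s = Max t"
  have "Min s \<le> Max s" "Min t \<le> Max t"
    using block_seq_FIN[OF X(1)] X(2,3) Min_le_Max_FIN by blast+
  then have "\<not> s <\<^sub>b t" "\<not> t <\<^sub>b s" using X(4) by (auto simp: blk_less_def)
  then show "s = t" using block_seq_cases[OF X(1-3)] by metis
qed

section \<open>Infinite block sequences, their finite unions and their enumeration\<close>

lemma FIN_omega_block_seq: "X \<in> FIN_omega \<Longrightarrow> block_seq X"
  by (simp add: FIN_omega_def)

lemma FIN_omega_unbounded:
  assumes "X \<in> FIN_omega"
  obtains t where "t \<in> X" "n < Min t"
proof -
  have "infinite (Min ` X)"
    using assms inj_on_Min_block_seq finite_image_iff unfolding FIN_omega_def by blast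
  then show ?thesis
    using that by (metis (no_types, lifting) finite_nat_set_iff_bounded_le imageE linorder_not_le)
qed

lemma Union_in_FU: "block_seq X \<Longrightarrow> S \<subseteq> X \<Longrightarrow> finite S \<Longrightarrow> S \<noteq> {} \<Longrightarrow> \<Union>S \<in> FU X"
  unfolding FU_def using block_seq_subset by blast

lemma subset_FU: "block_seq X \<Longrightarrow> X \<subseteq> FU X"
  using Union_in_FU[of X "{s}" for s] by auto

lemma Un_in_FU: "block_seq X \<Longrightarrow> s \<in> X \<Longrightarrow> t \<in> X \<Longrightarrow> s \<union> t \<in> FU X"
  using Union_in_FU[of X "{s, t}"] by auto

lemma FU_E:
  assumes "s \<in> FU X"
  obtains S where "S \<subseteq> X" "finite S" "S \<noteq> {}" "block_seq S" "s = \<Union>S"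
  using assms unfolding FU_def block_seq_def by blast

lemma FU_subset_FIN: "FU X \<subseteq> FIN"
  by (force elim!: FU_E simp: block_seq_def FIN_def)

text \<open>The members of \<open>S\<close> may overlap. Each is traced back to the blocks of
  \<open>X\<close> that compose it, and any finite non-empty set of blocks of \<open>X\<close> is
  again a block sequence.\<close>

lemma Union_FU_in_FU:
  assumes X: "block_seq X" and S: "S \<subseteq> FU X" "finite S" "S \<noteq> {}"
  shows "\<Union>S \<in> FU X"
proof -
  have "\<exists>R. R \<subseteq> X \<and> finite R \<and> R \<noteq> {} \<and> \<Union>R = t" if "t \<in> S" for t
    using that S(1) FU_E[of t X] by (metis subsetD)
  then obtain R where R: "\<And>t. t \<in> S \<Longrightarrow> R t \<subseteq> X \<and> finite (R t) \<and> R t \<noteq> {} \<and> \<Union>(R t) = t"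
    by metis
  have "\<Union>(\<Union>(R ` S)) = (\<Union>t\<in>S. \<Union>(R t))" by blast
  also have "\<dots> = \<Union>S" using R by simp
  finally have eq: "\<Union>(\<Union>(R ` S)) = \<Union>S" .
  have "\<Union>(\<Union>(R ` S)) \<in> FU X"
  proof (rule Union_in_FU[OF X])
    show "\<Union>(R ` S) \<subseteq> X" using R by blast
    show "finite (\<Union>(R ` S))" using R S(2) by blast
    obtain t where "t \<in> S" using S(3) by blast
    then have "R t \<noteq> {}" "R t \<subseteq> \<Union>(R ` S)" using R by blast+
    then show "\<Union>(R ` S) \<noteq> {}" by auto
  qed
  then show ?thesis by (simp only: eq)
qed

text \<open>Justifies the definite description in \<open>block_nth\<close>. The predecessors of a
  block are finite in number because their maxima are distinct and bounded by its minimum, and their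
  number grows strictly along the sequence.\<close>

lemma block_nth_index:
  assumes X: "X \<in> FIN_omega" and s: "s \<in> X"
  shows "block_nth X (card {t \<in> X. t <\<^sub>b s}) = s"
    and "finite {t \<in> X. t <\<^sub>b s}"
proof -
  have bX: "block_seq X" using X FIN_omega_block_seq by blast
  note F = block_seq_FIN[OF bX]
  have fin: "finite {t \<in> X. t <\<^sub>b u}" if u: "u \<in> X" for u
  proof (rule inj_on_finite[of Max])
    show "inj_on Max {t \<in> X. t <\<^sub>b u}"
      using inj_on_Max_block_seq[OF bX] by (rule inj_on_subset) auto
    show "Max ` {t \<in> X. t <\<^sub>b u} \<subseteq> {..Min u}" by (auto simp: blk_less_def)
  qed auto
  then show "finite {t \<in> X. t <\<^sub>b s}" using s by blast
  have less: "card {t \<in> X. t <\<^sub>b u} < card {t \<in> X. t <\<^sub>b v}" if "u \<in> X" "v \<in> X" "u <\<^sub>b v" for u v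
  proof (rule psubset_card_mono[OF fin[OF that(2)]])
    have "u \<notin> {t \<in> X. t <\<^sub>b u}" using blk_less_irrefl F that by blast
    then show "{t \<in> X. t <\<^sub>b u} \<subset> {t \<in> X. t <\<^sub>b v}"
      using that blk_less_trans F by blast
  qed
  show "block_nth X (card {t \<in> X. t <\<^sub>b s}) = s"
    unfolding block_nth_def
  proof (rule the_equality)
    fix u assume u: "u \<in> X \<and> card {t \<in> X. t <\<^sub>b u} = card {t \<in> X. t <\<^sub>b s}"
    then have "\<not> u <\<^sub>b s" "\<not> s <\<^sub>b u" using less[of u s] less[of s u] s by auto
    then show "u = s" using block_seq_cases[OF bX, of u s "u = s"] u s by argo
  qed (use s in auto)
qed

text \<open>Turns the "almost all indices" of stability into a statement about sets: counting
  predecessors maps the exceptional blocks injectively below \<open>m\<close>.\<close>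

lemma finite_exceptions:
  assumes X: "X \<in> FIN_omega" and m: "\<forall>i\<ge>m. block_nth X i \<in> B"
  shows "finite (X - B)"
proof (rule inj_on_finite[of "\<lambda>s. card {t \<in> X. t <\<^sub>b s}" _ "{..<m}"])
  let ?i = "\<lambda>s. card {t \<in> X. t <\<^sub>b s}"
  have nth: "block_nth X (?i s) = s" if "s \<in> X" for s
    using block_nth_index(1)[OF X that] .
  show "inj_on ?i (X - B)"
    by (rule inj_on_inverseI[of _ "block_nth X"]) (simp add: nth)
  show "?i ` (X - B) \<subseteq> {..<m}"
  proof (rule image_subsetI)
    fix s assume s: "s \<in> X - B"
    then have "block_nth X (?i s) \<notin> B" using nth[of s] by simp
    then have "\<not> m \<le> ?i s" using m by blast
    then show "?i s \<in> {..<m}" by simp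
  qed
qed auto

section \<open>Ordered-union ultrafilters\<close>

lemma ultrafilter_on_Int: "ultrafilter_on S U \<Longrightarrow> A \<in> U \<Longrightarrow> B \<in> U \<Longrightarrow> A \<inter> B \<in> U"
  by (simp add: ultrafilter_on_def)

lemma ultrafilter_on_mono: "ultrafilter_on S U \<Longrightarrow> A \<in> U \<Longrightarrow> A \<subseteq> B \<Longrightarrow> B \<subseteq> S \<Longrightarrow> B \<in> U"
  unfolding ultrafilter_on_def by blast

lemma ultrafilter_on_cases:
  assumes "ultrafilter_on S U" "A \<subseteq> S"
  obtains "A \<in> U" | "S - A \<in> U"
proof -
  have "A \<in> U \<or> S - A \<in> U" using assms by (simp add: ultrafilter_on_def)
  then show thesis using that by blast
qed

text \<open>The complement cannot lie in \<open>H\<close>: it would include some \<open>FU X\<close>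
  with \<open>X\<close> infinite, but the minima of the blocks of \<open>X\<close> are
  unbounded.\<close>

lemma ordered_union_Min_large:
  assumes uf: "ultrafilter_on FIN H" and ou: "ordered_union H"
  shows "{s \<in> FIN. k < Min s} \<in> H"
proof (rule ultrafilter_on_cases[OF uf, of "{s \<in> FIN. k < Min s}"])
  assume "FIN - {s \<in> FIN. k < Min s} \<in> H"
  then obtain X where X: "X \<in> FIN_omega" "FU X \<subseteq> FIN - {s \<in> FIN. k < Min s}"
    using ou unfolding ordered_union_def by blast
  obtain t where t: "t \<in> X" "k < Min t" using FIN_omega_unbounded[OF X(1)] by blast
  then have "t \<in> FU X" using subset_FU FIN_omega_block_seq[OF X(1)] by blast
  then show ?thesis using X(2) t by blast
qed auto

text \<open>Each gap between consecutive elements of \<open>s\<close> is counted by its left end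
  \<open>a\<close>. Some later element is at most \<open>h a\<close> exactly if the next one is, so
  successors need not be mentioned.\<close>

definition short_gaps :: "(nat \<Rightarrow> nat) \<Rightarrow> nat set \<Rightarrow> nat" where
  "short_gaps h s = card {a \<in> s. \<exists>b\<in>s. a < b \<and> b \<le> h a}"

text \<open>The only gap of the union that is new is the one from \<open>Max s\<close> to
  \<open>Min t\<close>; it contributes the last summand.\<close>

lemma short_gaps_Un:
  assumes s: "s \<in> FIN" and t: "t \<in> FIN" and st: "s <\<^sub>b t"
  shows "short_gaps h (s \<union> t) = short_gaps h s + short_gaps h t + (if Min t \<le> h (Max s) then 1 else 0)"
proof -
  let ?G = "\<lambda>s. {a \<in> s. \<exists>b\<in>s. a < b \<and> b \<le> h a}"
  let ?E = "if Min t \<le> h (Max s) then {Max s} else {}"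
  have fin: "finite s" "s \<noteq> {}" "finite t" "t \<noteq> {}" using s t by (auto simp: FIN_def)
  have lt: "\<And>a b. a \<in> s \<Longrightarrow> b \<in> t \<Longrightarrow> a < b" using st blk_less_iff[OF s t] by blast
  have ms: "Max s \<in> s" "Min t \<in> t" using fin by auto
  have 1: "?G (s \<union> t) \<subseteq> (?G s \<union> ?E) \<union> ?G t"
  proof
    fix a assume a: "a \<in> ?G (s \<union> t)"
    then obtain b where b: "b \<in> s \<union> t" "a < b" "b \<le> h a" by blast
    show "a \<in> (?G s \<union> ?E) \<union> ?G t"
    proof (cases "a \<in> t")
      case True
      then have "b \<in> t" using b lt by fastforce
      then show ?thesis using True b by blast
    next
      case False
      then have as: "a \<in> s" using a by blast
      show ?thesis
      proof (cases "a = Max s")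
        case True
        then have "b \<in> t" using b(1,2) fin(1) Max_ge[of s b] by fastforce
        then have "Min t \<le> h (Max s)" using Min_le[of t b] fin(3) b(3) True le_trans by blast
        then show ?thesis using True by auto
      next
        case False
        then have "a < Max s" using as fin by (simp add: order.not_eq_order_implies_strict)
        \<comment> \<open>If the witness \<open>b\<close> lies in \<open>t\<close>, then
          \<open>Max s\<close> is a witness inside \<open>s\<close>, since it lies strictly above
          \<open>a\<close> and below \<open>b\<close>.\<close>
        moreover have "Max s \<le> b \<or> b \<in> s" using b lt ms by fastforce
        ultimately have "\<exists>b\<in>s. a < b \<and> b \<le> h a" using b ms by (meson order_trans)
        then show ?thesis using as by blast
      qed
    qed
  qed
  have 2: "(?G s \<union> ?E) \<union> ?G t \<subseteq> ?G (s \<union> t)"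
    using ms lt[OF ms] by auto
  have d1: "Max s \<notin> ?G s" using fin Max_ge[of s] by fastforce
  have "s \<inter> t = {}" using lt by blast
  then have d2: "(?G s \<union> ?E) \<inter> ?G t = {}" using ms(1) by (auto split: if_splits)
  have "?G (s \<union> t) = (?G s \<union> ?E) \<union> ?G t" using 1 2 by blast
  then have "short_gaps h (s \<union> t) = card (?G s \<union> ?E) + card (?G t)"
    unfolding short_gaps_def using d2 fin by (simp add: card_Un_disjoint)
  also have "card (?G s \<union> ?E) = card (?G s) + card ?E"
    using d1 fin by (intro card_Un_disjoint) auto
  finally show ?thesis unfolding short_gaps_def by simp
qed

text \<open>Colouring \<open>s\<close> by the parity of the number of its short gaps, a set of constant colour
  must have colour even, and then no gap between two of its blocks is short.\<close>

lemma ordered_union_gaps: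
  fixes h :: "nat \<Rightarrow> nat"
  assumes uf: "ultrafilter_on FIN H" and ou: "ordered_union H" and A: "A \<in> H"
  shows "\<exists>Y\<in>FIN_omega. FU Y \<in> H \<and> FU Y \<subseteq> A \<and>
    (\<forall>s\<in>Y. \<forall>t\<in>Y. s <\<^sub>b t \<longrightarrow> h (Max s) < Min t)"
proof -
  let ?B = "{s \<in> FIN. even (short_gaps h s)}"
  have "\<exists>B\<in>H. B \<subseteq> A \<and> (\<forall>s\<in>B. \<forall>t\<in>B. even (short_gaps h s) = even (short_gaps h t))"
  proof (rule ultrafilter_on_cases[OF uf, of ?B])
    assume "?B \<in> H"
    then have "A \<inter> ?B \<in> H" using ultrafilter_on_Int uf A by blast
    then show ?thesis by (rule rev_bexI) auto
  next
    assume "FIN - ?B \<in> H"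
    then have "A \<inter> (FIN - ?B) \<in> H" using ultrafilter_on_Int uf A by blast
    then show ?thesis by (rule rev_bexI) auto
  qed auto
  then obtain B where B: "B \<in> H" "B \<subseteq> A"
    "\<And>s t. s \<in> B \<Longrightarrow> t \<in> B \<Longrightarrow> even (short_gaps h s) = even (short_gaps h t)" by blast
  obtain Y where Y: "Y \<in> FIN_omega" "FU Y \<in> H" "FU Y \<subseteq> B"
    using ou B(1) unfolding ordered_union_def by blast
  have bY: "block_seq Y" using Y(1) FIN_omega_block_seq by blast
  have par: "even (short_gaps h s) = even (short_gaps h t)"
    "even (short_gaps h (s \<union> t)) = even (short_gaps h t)" if "s \<in> Y" "t \<in> Y" for s t
    using that B(3) Y(3) Un_in_FU[OF bY] subset_FU[OF bY] by (meson subsetD)+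
  \<comment> \<open>With \<open>t\<close> so far out that the gap between them is long, the counts
    of \<open>s\<close> and \<open>t\<close> add up. As \<open>s\<close>, \<open>t\<close> and their
    union have the same parity, this parity is even.\<close>
  have ev: "even (short_gaps h s)" if s: "s \<in> Y" for s
  proof -
    obtain t where t: "t \<in> Y" "max (Max s) (h (Max s)) < Min t"
      using FIN_omega_unbounded[OF Y(1)] by blast
    then have "s <\<^sub>b t" by (simp add: blk_less_def)
    then have "short_gaps h (s \<union> t) = short_gaps h s + short_gaps h t"
      using short_gaps_Un[of s t h] block_seq_FIN[OF bY] s t by simp
    then show ?thesis using par[OF s t(1)] by simp
  qed
  have "h (Max s) < Min t" if st: "s \<in> Y" "t \<in> Y" "s <\<^sub>b t" for s t
  proof (rule ccontr)
    assume "\<not> h (Max s) < Min t"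
    then have "short_gaps h (s \<union> t) = short_gaps h s + short_gaps h t + 1"
      using short_gaps_Un[of s t h] block_seq_FIN[OF bY] st by simp
    then show False using par[OF st(1,2)] ev[OF st(1)] ev[OF st(2)] by simp
  qed
  then show ?thesis using Y B(2) by blast
qed

text \<open>The start of the gap in front of a block \<open>t\<close> of \<open>Y\<close>: one past
  the maximum of the preceding block, or 0 if \<open>t\<close> is the first.\<close>

definition pred_bound :: "nat set set \<Rightarrow> nat set \<Rightarrow> nat" where
  "pred_bound Y t = (LEAST j. \<forall>s\<in>Y. s <\<^sub>b t \<longrightarrow> Max s < j)"

lemma pred_bound_less: "s \<in> Y \<Longrightarrow> s <\<^sub>b t \<Longrightarrow> Max s < pred_bound Y t"
proof -
  \<comment> \<open>\<open>Min t\<close> is an admissible value, so the least one exists.\<close>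
  have "\<forall>s\<in>Y. s <\<^sub>b t \<longrightarrow> Max s < Min t" by (simp add: blk_less_def)
  then have "\<forall>s\<in>Y. s <\<^sub>b t \<longrightarrow> Max s < pred_bound Y t"
    unfolding pred_bound_def by (rule LeastI[of "\<lambda>j. \<forall>s\<in>Y. s <\<^sub>b t \<longrightarrow> Max s < j"])
  then show "s \<in> Y \<Longrightarrow> s <\<^sub>b t \<Longrightarrow> Max s < pred_bound Y t" by blast
qed

lemma pred_bound_cases:
  obtains "pred_bound Y t = 0" | s where "s \<in> Y" "s <\<^sub>b t" "pred_bound Y t = Suc (Max s)"
proof (cases "pred_bound Y t")
  case (Suc j)
  then have "j < (LEAST j. \<forall>s\<in>Y. s <\<^sub>b t \<longrightarrow> Max s < j)" by (simp add: pred_bound_def)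
  then have "\<not> (\<forall>s\<in>Y. s <\<^sub>b t \<longrightarrow> Max s < j)" by (rule not_less_Least)
  then obtain s where s: "s \<in> Y" "s <\<^sub>b t" "j \<le> Max s" by force
  moreover have "Max s < pred_bound Y t" using pred_bound_less s by blast
  ultimately show ?thesis using that Suc by (metis le_antisym less_Suc_eq_le)
qed (use that in blast)

text \<open>Here \<open>t\<close> is the last block used in \<open>s\<close>, and \<open>b\<close>
  collects the earlier ones, which end before the gap in front of \<open>t\<close>. \<open>b\<close>
  may be empty.\<close>

lemma FU_decompose:
  assumes Y: "block_seq Y" and s: "s \<in> FU Y"
  obtains t b where "t \<in> Y" "b \<subseteq> {..<pred_bound Y t}" "s = b \<union> t" "Max s = Max t"
proof -
  obtain S where S: "S \<subseteq> Y" "finite S" "S \<noteq> {}" "s = \<Union>S" using s FU_E by metis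
  note F = block_seq_FIN[OF Y]
  have "Max (Max ` S) \<in> Max ` S" using S by (intro Max_in) auto
  then obtain t where t: "t \<in> S" "Max (Max ` S) = Max t" by blast
  then have t: "t \<in> S" "\<And>r. r \<in> S \<Longrightarrow> Max r \<le> Max t"
    using Max_ge[of "Max ` S"] S(2) by (force, metis finite_imageI image_eqI)
  have lt: "r <\<^sub>b t" if "r \<in> S" "r \<noteq> t" for r
    using block_seq_cases[OF Y, of r t] that t S(1) F Min_le_Max_FIN[of r] unfolding blk_less_def
    by (metis le_less_trans not_le subsetD)
  have "\<Union>(S - {t}) \<subseteq> {..<pred_bound Y t}"
  proof
    fix a assume "a \<in> \<Union>(S - {t})"
    then obtain r where r: "r \<in> S" "r \<noteq> t" "a \<in> r" by blast
    then have "a \<le> Max r" using F S(1) by (meson FIN_iff Max_ge subsetD)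
    also have "\<dots> < pred_bound Y t" using pred_bound_less lt r S(1) by blast
    finally show "a \<in> {..<pred_bound Y t}" by simp
  qed
  moreover have "s = \<Union>(S - {t}) \<union> t" using S t by blast
  moreover have "Max s = Max t"
  proof (rule Max_eqI)
    have fin: "finite r" if "r \<in> S" for r using F S(1) that by (meson FIN_iff subsetD)
    then show "finite s" using S by blast
    have "t \<in> FIN" using F S(1) t(1) by blast
    then have "Max t \<in> t" by (simp add: FIN_def)
    then show "Max t \<in> s" using S(4) t(1) by blast
    fix a assume "a \<in> s"
    then obtain r where "r \<in> S" "a \<in> r" using S by blast
    then show "a \<le> Max t" using t(2) fin by (meson Max_ge le_trans)
  qed
  ultimately show ?thesis using that t S(1) by blast
qed

text \<open>Stability of \<open>H\<close> is used only here.\<close>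

lemma stable_diagonal:
  fixes g :: "nat \<Rightarrow> nat"
  assumes H: "stable_ordered_union_ultrafilter H" and A: "\<And>n. A n \<in> H"
  shows "\<exists>Y\<in>FIN_omega. FU Y \<in> H \<and>
    (\<forall>t\<in>Y. t \<in> A (g (pred_bound Y t)) \<and> g (pred_bound Y t) < Min t)"
proof -
  have uf: "ultrafilter_on FIN H" and ou: "ordered_union H" and st: "stable H"
    using H by (auto simp: stable_ordered_union_ultrafilter_def)
  have "\<forall>n. \<exists>X. X \<in> FIN_omega \<and> FU X \<in> H \<and> FU X \<subseteq> A n"
    using ou A unfolding ordered_union_def by blast
  then obtain X where X: "\<And>n. X n \<in> FIN_omega \<and> FU (X n) \<in> H \<and> FU (X n) \<subseteq> A n"
    by metis
  then obtain Z where Z: "Z \<in> FIN_omega" "FU Z \<in> H"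
    "\<And>n. \<exists>m. \<forall>i\<ge>m. block_nth Z i \<in> FU (X n)"
    using st unfolding stable_def by meson
  have "finite (Z - FU (X n))" for n using finite_exceptions[OF Z(1)] Z(3) by blast
  then have "finite (Min ` (Z - FU (X n)))" for n by blast
  then have "\<forall>n. \<exists>h. \<forall>a\<in>Min ` (Z - FU (X n)). a \<le> h"
    using finite_nat_set_iff_bounded_le by meson
  then obtain h where h: "\<And>n t. t \<in> Z \<Longrightarrow> h n < Min t \<Longrightarrow> t \<in> FU (X n)"
    by (metis (no_types, lifting) DiffI image_eqI not_le)
  \<comment> \<open>All blocks of \<open>Z\<close> that make up \<open>s\<close> start beyond
    \<open>h n\<close>, hence belong to \<open>FU (X n)\<close>, which is closed under finite
    unions.\<close>
  have large: "s \<in> A n" if s: "s \<in> FU Z" "h n < Min s" for s n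
  proof -
    obtain S where S: "S \<subseteq> Z" "finite S" "S \<noteq> {}" "s = \<Union>S" using s FU_E by metis
    have fin: "finite s" using s FU_subset_FIN by (auto simp: FIN_def)
    have "t \<in> FU (X n)" if t: "t \<in> S" for t
    proof -
      have "t \<subseteq> s" "t \<noteq> {}"
        using S t block_seq_FIN[OF FIN_omega_block_seq[OF Z(1)]] by (auto simp: FIN_def)
      then have "Min s \<le> Min t" using fin Min_antimono by blast
      then show ?thesis using h S(1) s(2) t by (meson less_le_trans subsetD)
    qed
    then have "\<Union>S \<in> FU (X n)"
      using S X FIN_omega_block_seq by (intro Union_FU_in_FU) auto
    then show ?thesis using S X by blast
  qed
  \<comment> \<open>The bound \<open>g j\<close> secures the gap, and \<open>h (g j)\<close> secures
    membership in \<open>A (g j)\<close>.\<close>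
  define k where "k j = max (g j) (h (g j))" for j
  \<comment> \<open>The first block has \<open>pred_bound\<close> 0 and needs this separate bound. A
    later block has \<open>pred_bound\<close> equal to \<open>Suc (Max s)\<close> for its
    predecessor \<open>s\<close>, whence the spacing function \<open>k (Suc n)\<close>
    below.\<close>
  have "FU Z \<inter> {s \<in> FIN. k 0 < Min s} \<in> H"
    using ultrafilter_on_Int[OF uf Z(2)] ordered_union_Min_large[OF uf ou] by blast
  then obtain Y where Y: "Y \<in> FIN_omega" "FU Y \<in> H" "FU Y \<subseteq> FU Z \<inter> {s \<in> FIN. k 0 < Min s}"
    "\<And>s t. s \<in> Y \<Longrightarrow> t \<in> Y \<Longrightarrow> s <\<^sub>b t \<Longrightarrow> k (Suc (Max s)) < Min t"
    using ordered_union_gaps[OF uf ou, of _ "\<lambda>n. k (Suc n)"] by blast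
  have YZ: "t \<in> FU Z \<and> k 0 < Min t" if "t \<in> Y" for t
    using that Y(3) subset_FU[OF FIN_omega_block_seq[OF Y(1)]] by blast
  have "k (pred_bound Y t) < Min t" if t: "t \<in> Y" for t
    by (rule pred_bound_cases[of Y t]) (use YZ[OF t] Y(4)[OF _ t] in auto)
  then have "g (pred_bound Y t) < Min t" "h (g (pred_bound Y t)) < Min t" if "t \<in> Y" for t
    using that by (simp_all add: k_def)
  then show ?thesis using Y(1,2) large YZ by blast
qed

section \<open>Conditions\<close>

lemma H_conditions_cofinal:
  assumes p: "p \<in> H_conditions H" and f: "f \<in> p"
  shows "\<exists>g\<in>p. prefix f g \<and> n \<le> length g"
proof -
  have "\<forall>f\<in>p. \<forall>n\<ge>length f. \<exists>g\<in>p. prefix f g \<and> n \<le> length g"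
    using p by (simp add: H_conditions_def)
  then obtain g where "g \<in> p" "prefix f g" "max n (length f) \<le> length g"
    using f by (meson max.cobounded2)
  then show ?thesis by auto
qed

lemma H_conditionsD:
  assumes "p \<in> H_conditions H"
  shows "f \<in> p \<Longrightarrow> prefix g f \<Longrightarrow> g \<in> p"
    and "f \<in> p \<Longrightarrow> f \<in> TT"
    and "[] \<in> p"
    and "f \<in> p \<Longrightarrow> \<exists>g\<in>p. prefix f g \<and> n \<le> length g"
    and "big_heights p k \<in> H"
proof -
  have *: "subtree p" "[] \<in> p" "\<forall>k. big_heights p k \<in> H"
    using assms by (simp_all add: H_conditions_def)
  show "f \<in> p \<Longrightarrow> prefix g f \<Longrightarrow> g \<in> p" "f \<in> p \<Longrightarrow> f \<in> TT"
    using *(1) unfolding subtree_def by blast+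
  show "f \<in> p \<Longrightarrow> \<exists>g\<in>p. prefix f g \<and> n \<le> length g"
    using H_conditions_cofinal[OF assms] .
qed (use assms in \<open>simp_all add: H_conditions_def\<close>)

lemma H_conditions_extend:
  assumes "p \<in> H_conditions H" "f \<in> p" "length f \<le> n"
  obtains g where "g \<in> p" "prefix f g" "length g = n"
proof -
  obtain g where g: "g \<in> p" "prefix f g" "n \<le> length g" using H_conditionsD(4)[OF assms(1,2)] by blast
  have "prefix f (take n g)" using g assms(3) by (auto simp: prefix_def)
  moreover have "take n g \<in> p" using H_conditionsD(1)[OF assms(1)] g take_is_prefix by blast
  ultimately show ?thesis using that g by force
qed

text \<open>A pattern on the subsets of \<open>k\<close> extends to the subsets of \<open>n\<close>
  by ignoring the part of the argument outside \<open>k\<close>.\<close>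

lemma big_mono:
  assumes "big n s B" "k \<le> n"
  shows "big k s B"
  unfolding big_def
proof
  fix \<sigma> assume "\<sigma> \<in> cube k"
  let ?\<sigma> = "restrict (\<lambda>w. \<sigma> (w \<inter> {..<k})) (Pow {..<n})"
  have "?\<sigma> \<in> cube n" by (auto simp: cube_def)
  then obtain \<tau> where \<tau>: "\<tau> \<in> B" "\<forall>u\<in>Pow {..<n}. ?\<sigma> u = \<tau> (u \<union> (s - {Max s}))"
    using assms(1) unfolding big_def by blast
  have "\<sigma> u = \<tau> (u \<union> (s - {Max s}))" if u: "u \<in> Pow {..<k}" for u
  proof -
    have "u \<in> Pow {..<n}" using u assms(2) by fastforce
    then have "?\<sigma> u = \<tau> (u \<union> (s - {Max s}))" using \<tau>(2) by blast
    moreover have "u \<inter> {..<k} = u" using u by blast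
    ultimately show ?thesis using \<open>u \<in> Pow {..<n}\<close> by (simp add: restrict_apply')
  qed
  then show "\<exists>\<tau>\<in>B. \<forall>u\<in>Pow {..<k}. \<sigma> u = \<tau> (u \<union> (s - {Max s}))" using \<tau>(1) by blast
qed

lemma big_superset: "big k s A \<Longrightarrow> A \<subseteq> B \<Longrightarrow> big k s B"
  unfolding big_def by (meson subsetD)

section \<open>Restricting a condition to a node\<close>

definition restrict_to :: "'a list set \<Rightarrow> 'a list \<Rightarrow> 'a list set" where
  "restrict_to p f = {g \<in> p. prefix g f \<or> prefix f g}"

text \<open>From the length of \<open>f\<close> on, every remaining node extends \<open>f\<close>
  and keeps all its successors in \<open>p\<close>. Asking for bigness in \<open>p\<close> at
  \<open>max k (length f)\<close> confines attention to these heights.\<close>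

lemma restrict_to_condition:
  assumes uf: "ultrafilter_on FIN H" and p: "p \<in> H_conditions H" and f: "f \<in> p"
  shows "restrict_to p f \<in> H_conditions H"
proof -
  let ?q = "restrict_to p f"
  have "subtree ?q"
    unfolding subtree_def restrict_to_def
    using H_conditionsD(1,2)[OF p] prefix_same_cases prefix_order.trans by blast
  moreover have "[] \<in> ?q" using H_conditionsD(3)[OF p] by (simp add: restrict_to_def)
  moreover have "\<exists>g'\<in>?q. prefix g g' \<and> n \<le> length g'" if g: "g \<in> ?q" for g n
  proof -
    obtain k where k: "k \<in> p" "prefix f k" "prefix g k"
      using g f unfolding restrict_to_def by blast
    obtain g' where "g' \<in> p" "prefix k g'" "n \<le> length g'" using H_conditionsD(4)[OF p k(1)] by blast
    then have "g' \<in> ?q" "prefix g g'" "n \<le> length g'"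
      using k unfolding restrict_to_def by (auto intro: prefix_order.trans)
    then show ?thesis by blast
  qed
  moreover have "big_heights ?q k \<in> H" for k
  proof (rule ultrafilter_on_mono[OF uf H_conditionsD(5)[OF p, of "max k (length f)"]])
    show "big_heights p (max k (length f)) \<subseteq> big_heights ?q k"
    proof
      fix s assume s: "s \<in> big_heights p (max k (length f))"
      have "big k s (succs ?q g)" if g: "g \<in> Lev (Max s) ?q" for g
      proof -
        have gp: "g \<in> Lev (Max s) p" "length f \<le> length g"
          using g s unfolding Lev_def restrict_to_def big_heights_def by auto
        then have fg: "prefix f g"
          using g unfolding Lev_def restrict_to_def using prefix_length_le prefix_order.eq_iff
          by (metis (no_types, lifting) le_antisym mem_Collect_eq not_equal_is_parallel parallelE)
        have "succs p g \<subseteq> succs ?q g"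
          using fg by (auto simp: succs_def restrict_to_def)
        moreover have "big (max k (length f)) s (succs p g)"
          using gp s unfolding big_heights_def by blast
        then have "big k s (succs p g)" by (rule big_mono) simp
        ultimately show ?thesis by (rule big_superset[rotated])
      qed
      then show "s \<in> big_heights ?q k" using s unfolding big_heights_def by auto
    qed
    show "big_heights ?q k \<subseteq> FIN" by (auto simp: big_heights_def)
  qed
  ultimately show ?thesis unfolding H_conditions_def by blast
qed

text \<open>For \<open>\<tau>\<close> the value of the branch at height \<open>Max t\<close>, this
  says that the colour of the union of \<open>w\<close> and \<open>t\<close> changes when a
  non-empty part \<open>v\<close> of the gap \<open>{j..<n}\<close> is added.\<close>

definition flips :: "nat \<Rightarrow> nat \<Rightarrow> nat set \<Rightarrow> (nat set \<Rightarrow> bool) \<Rightarrow> bool" where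
  "flips j n t \<tau> \<longleftrightarrow> (\<forall>w\<subseteq>{..<j}. \<forall>v\<subseteq>{j..<n}. v \<noteq> {} \<longrightarrow>
     \<tau> (w \<union> v \<union> (t - {Max t})) \<noteq> \<tau> (w \<union> (t - {Max t})))"

text \<open>Bigness at \<open>n\<close> realises every pattern on the subsets of \<open>n\<close>.
  The pattern chosen is \<open>\<sigma>\<close>, negated exactly on the sets that meet
  \<open>{j..<n}\<close>; on subsets of \<open>j\<close> it is \<open>\<sigma>\<close>
  itself.\<close>

lemma big_flips:
  assumes big: "big n t B" and jn: "j \<le> n" and kj: "k \<le> j" and \<sigma>: "\<sigma> \<in> cube k"
  obtains \<tau> where "\<tau> \<in> B" "flips j n t \<tau>"
    "\<And>w. w \<subseteq> {..<j} \<Longrightarrow> \<tau> (w \<union> (t - {Max t})) = \<sigma> (w \<inter> {..<k})"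
proof -
  let ?\<sigma> = "restrict (\<lambda>w. \<sigma> (w \<inter> {..<k}) \<noteq> (w \<inter> {j..<n} \<noteq> {})) (Pow {..<n})"
  have "?\<sigma> \<in> cube n" by (auto simp: cube_def)
  then obtain \<tau> where \<tau>: "\<tau> \<in> B" "\<forall>u\<in>Pow {..<n}. ?\<sigma> u = \<tau> (u \<union> (t - {Max t}))"
    using big unfolding big_def by blast
  have eq: "\<tau> (u \<union> (t - {Max t})) \<longleftrightarrow> \<sigma> (u \<inter> {..<k}) \<noteq> (u \<inter> {j..<n} \<noteq> {})" if "u \<subseteq> {..<n}" for u
  proof -
    have "?\<sigma> u = \<tau> (u \<union> (t - {Max t}))" using \<tau>(2) that by blast
    then show ?thesis using that by (simp add: restrict_apply')
  qed
  have low: "w \<subseteq> {..<n}" "w \<inter> {j..<n} = {}" if "w \<subseteq> {..<j}" for w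
    using that jn by fastforce+
  have val: "\<tau> (w \<union> (t - {Max t})) = \<sigma> (w \<inter> {..<k})" if "w \<subseteq> {..<j}" for w
    using eq[of w] low[OF that] by blast
  moreover have "flips j n t \<tau>"
    unfolding flips_def
  proof (intro allI impI)
    fix w v :: "nat set" assume w: "w \<subseteq> {..<j}" and v: "v \<subseteq> {j..<n}" "v \<noteq> {}"
    have "w \<union> v \<subseteq> {..<n}" "(w \<union> v) \<inter> {j..<n} \<noteq> {}" "(w \<union> v) \<inter> {..<k} = w \<inter> {..<k}"
      using w v low(1)[OF w] kj by fastforce+
    then show "\<tau> (w \<union> v \<union> (t - {Max t})) \<noteq> \<tau> (w \<union> (t - {Max t}))"
      using eq[of "w \<union> v"] val[OF w] by metis
  qed
  ultimately show ?thesis using that \<tau>(1) by blast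
qed

definition thin :: "(nat set \<Rightarrow> bool) list set \<Rightarrow> (nat \<Rightarrow> nat) \<Rightarrow> nat set set \<Rightarrow>
    (nat set \<Rightarrow> bool) list set" where
  "thin p g Y = {f \<in> p. \<forall>t\<in>Y. Max t < length f \<longrightarrow>
     flips (pred_bound Y t) (g (pred_bound Y t)) t (f ! Max t)}"

text \<open>At height \<open>Max t\<close>, bigness up to \<open>g (pred_bound Y t)\<close> pays for
  the flips and still leaves bigness up to \<open>pred_bound Y t\<close>. The latter absorbs the
  part \<open>b\<close> of a member of \<open>FU Y\<close> with last block \<open>t\<close>.\<close>

lemma thin_condition:
  assumes H: "stable_ordered_union_ultrafilter H" and p: "p \<in> H_conditions H"
    and g: "\<And>n. n \<le> g n"
    and Y: "Y \<in> FIN_omega" "FU Y \<in> H"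
    and Ybig: "\<And>t. t \<in> Y \<Longrightarrow> t \<in> big_heights p (g (pred_bound Y t))"
    and Ygap: "\<And>t. t \<in> Y \<Longrightarrow> g (pred_bound Y t) < Min t"
  shows "thin p g Y \<in> H_conditions H"
proof -
  have uf: "ultrafilter_on FIN H" and ou: "ordered_union H"
    using H by (auto simp: stable_ordered_union_ultrafilter_def)
  let ?q = "thin p g Y" let ?J = "pred_bound Y"
  have bY: "block_seq Y" using Y(1) FIN_omega_block_seq by blast
  have qp: "f \<in> p" if "f \<in> ?q" for f using that by (simp add: thin_def)
  have Snoc: "f @ [\<tau>] \<in> ?q"
    if f: "f \<in> ?q" and \<tau>: "f @ [\<tau>] \<in> p" "\<And>t. t \<in> Y \<Longrightarrow> Max t = length f \<Longrightarrow> flips (?J t) (g (?J t)) t \<tau>"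
    for f \<tau>
    using that unfolding thin_def by (auto simp: nth_append less_Suc_eq)
  have splitting: "\<exists>\<tau>\<in>succs ?q f. \<forall>w\<subseteq>{..<?J t}. \<tau> (w \<union> (t - {Max t})) = \<sigma> (w \<inter> {..<k})"
    if t: "t \<in> Y" and f: "f \<in> Lev (Max t) ?q" and k: "k \<le> ?J t" "\<sigma> \<in> cube k" for t f k \<sigma>
  proof -
    have "big (g (?J t)) t (succs p f)"
      using Ybig[OF t] f qp unfolding big_heights_def Lev_def by blast
    then obtain \<tau> where \<tau>: "\<tau> \<in> succs p f" "flips (?J t) (g (?J t)) t \<tau>"
      "\<And>w. w \<subseteq> {..<?J t} \<Longrightarrow> \<tau> (w \<union> (t - {Max t})) = \<sigma> (w \<inter> {..<k})"
      using big_flips[OF _ g k] by blast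
    have "f @ [\<tau>] \<in> ?q"
    proof (rule Snoc)
      fix t' assume t': "t' \<in> Y" "Max t' = length f"
      \<comment> \<open>Distinct blocks have distinct maxima, so each height carries at most one
        demand.\<close>
      then have "t' = t" using inj_on_Max_block_seq[OF bY] t f by (auto simp: Lev_def dest: inj_onD)
      then show "flips (?J t') (g (?J t')) t' \<tau>" using \<tau>(2) by simp
    qed (use f \<tau> in \<open>auto simp: Lev_def succs_def\<close>)
    then show ?thesis using \<tau>(3) unfolding succs_def by blast
  qed
  have step: "\<exists>\<tau>. f @ [\<tau>] \<in> ?q" if f: "f \<in> ?q" for f
  proof (cases "\<exists>t\<in>Y. Max t = length f")
    case True
    then obtain t where t: "t \<in> Y" "f \<in> Lev (Max t) ?q" using f by (auto simp: Lev_def)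
    \<comment> \<open>Only the existence of a successor matters here, so the pattern to be realised
      is an arbitrary one with \<open>k\<close> equal to 0.\<close>
    have "restrict (\<lambda>_. True) (Pow {..<0}) \<in> cube 0" by (auto simp: cube_def)
    then show ?thesis using splitting[OF t, of 0] unfolding succs_def by blast
  next
    case False
    obtain h where h: "h \<in> p" "prefix f h" "length h = Suc (length f)"
      using H_conditions_extend[OF p qp[OF f], of "Suc (length f)"] by auto
    then obtain zs where zs: "h = f @ zs" "length zs = Suc 0" by (auto elim: prefixE)
    then obtain \<tau> where "h = f @ [\<tau>]" by (metis length_0_conv length_Suc_conv)
    then show ?thesis using Snoc[OF f, of \<tau>] False h(1) by blast
  qed
  have ext: "\<exists>h\<in>?q. prefix f h \<and> length h = length f + n" if f: "f \<in> ?q" for f n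
  proof (induction n)
    case 0 then show ?case using f by auto
  next
    case (Suc n)
    then obtain h where h: "h \<in> ?q" "prefix f h" "length h = length f + n" by blast
    then obtain \<tau> where "h @ [\<tau>] \<in> ?q" using step by blast
    then show ?case using h by (intro bexI[of _ "h @ [\<tau>]"]) auto
  qed
  have "subtree ?q"
    unfolding subtree_def
  proof (intro conjI ballI allI impI)
    show "?q \<subseteq> TT" using H_conditionsD(2)[OF p] qp by blast
    fix f h assume fh: "f \<in> ?q" "prefix h f"
    then obtain zs where zs: "f = h @ zs" by (auto elim: prefixE)
    have "h \<in> p" using H_conditionsD(1)[OF p qp] fh by blast
    moreover have "f ! n = h ! n \<and> n < length f" if "n < length h" for n
      using that zs by (simp add: nth_append)
    ultimately show "h \<in> ?q" using fh(1) unfolding thin_def by auto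
  qed
  moreover have "[] \<in> ?q" using H_conditionsD(3)[OF p] by (simp add: thin_def)
  moreover have "\<exists>h\<in>?q. prefix f h \<and> n \<le> length h" if "f \<in> ?q" for f n
    using ext[OF that, of n] by force
  moreover have "big_heights ?q k \<in> H" for k
  proof -
    \<comment> \<open>A block following \<open>y\<close> has its \<open>pred_bound\<close> above
      \<open>Max y\<close> and hence above \<open>k\<close>, as \<open>splitting\<close> requires.
      Members of \<open>FU Y\<close> that start after \<open>y\<close> have such a last block, and
      they form a set in \<open>H\<close>.\<close>
    obtain y where y: "y \<in> Y" "k < Min y" using FIN_omega_unbounded[OF Y(1)] by blast
    then have ky: "k \<le> Max y" using Min_le_Max_FIN block_seq_FIN[OF bY y(1)] by (meson le_trans less_imp_le)
    have "FU Y \<inter> {s \<in> FIN. Max y < Min s} \<in> H"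
      using ultrafilter_on_Int[OF uf Y(2)] ordered_union_Min_large[OF uf ou] by blast
    moreover have "FU Y \<inter> {s \<in> FIN. Max y < Min s} \<subseteq> big_heights ?q k"
    proof
      fix s assume "s \<in> FU Y \<inter> {s \<in> FIN. Max y < Min s}"
      then have s: "s \<in> FU Y" "s \<in> FIN" "Max y < Min s" by auto
      obtain t b where tb: "t \<in> Y" "b \<subseteq> {..<?J t}" "s = b \<union> t" "Max s = Max t"
        using FU_decompose[OF bY s(1)] .
      have fin: "finite s" "t \<noteq> {}" using s(2) block_seq_FIN[OF bY tb(1)] by (auto simp: FIN_def)
      then have "Min s \<le> Min t" using tb(3) by (intro Min_antimono) auto
      then have "y <\<^sub>b t" using s(3) by (simp add: blk_less_def)
      then have kJ: "k \<le> ?J t" using pred_bound_less[OF y(1)] ky by (meson le_trans less_imp_le)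
      have "k < Min s" using ky s(3) by simp
      \<comment> \<open>This disjointness lets \<open>u\<close> be recovered from its union with
        \<open>b\<close> by intersecting with \<open>k\<close>.\<close>
      then have bk: "b \<inter> {..<k} = {}" using fin Min_le[of s] tb(3) by fastforce
      have "Max t \<notin> b"
      proof
        assume "Max t \<in> b"
        then have "Max t < ?J t" using tb(2) by blast
        then show False
          using Ygap[OF tb(1)] g[of "?J t"] Min_le_Max_FIN[OF block_seq_FIN[OF bY tb(1)]] by linarith
      qed
      \<comment> \<open>Shifting \<open>u\<close> by \<open>s - {Max s}\<close> amounts to adding
        \<open>b\<close> first and then shifting by \<open>t - {Max t}\<close>, where the value is
        under control.\<close>
      then have minus: "u \<union> (s - {Max s}) = (u \<union> b) \<union> (t - {Max t})" for u using tb by auto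
      have "big k s (succs ?q f)" if f: "f \<in> Lev (Max s) ?q" for f
        unfolding big_def
      proof
        have f': "f \<in> Lev (Max t) ?q" using f tb(4) by simp
        fix \<sigma> assume "\<sigma> \<in> cube k"
        then obtain \<tau> where \<tau>: "\<tau> \<in> succs ?q f"
          "\<And>w. w \<subseteq> {..<?J t} \<Longrightarrow> \<tau> (w \<union> (t - {Max t})) = \<sigma> (w \<inter> {..<k})"
          using splitting[OF tb(1) f' kJ] by blast
        have "\<sigma> u = \<tau> (u \<union> (s - {Max s}))" if u: "u \<in> Pow {..<k}" for u
        proof -
          have "u \<union> b \<subseteq> {..<?J t}" "(u \<union> b) \<inter> {..<k} = u" using u kJ bk tb(2) by fastforce+
          then show ?thesis using \<tau>(2)[of "u \<union> b"] minus by metis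
        qed
        then show "\<exists>\<tau>\<in>succs ?q f. \<forall>u\<in>Pow {..<k}. \<sigma> u = \<tau> (u \<union> (s - {Max s}))"
          using \<tau>(1) by blast
      qed
      moreover have "k \<le> Max s" using \<open>k < Min s\<close> Min_le_Max_FIN[OF s(2)] by simp
      ultimately show "s \<in> big_heights ?q k" unfolding big_heights_def using s(2) by blast
    qed
    ultimately show ?thesis by (rule ultrafilter_on_mono[OF uf]) (auto simp: big_heights_def)
  qed
  ultimately show ?thesis unfolding H_conditions_def by blast
qed

section \<open>The forcing relation\<close>

locale forcing =
  fixes Q :: "'q rel"
  assumes Q: "forcing_notion Q"
begin

lemma le_refl: "p \<in> Field Q \<Longrightarrow> (p, p) \<in> Q"
  using Q unfolding forcing_notion_def preorder_on_def refl_on_def by blast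

lemma le_trans: "(r, q) \<in> Q \<Longrightarrow> (q, p) \<in> Q \<Longrightarrow> (r, p) \<in> Q"
  using Q unfolding forcing_notion_def preorder_on_def by (meson transD)

lemma le_Field: "(q, p) \<in> Q \<Longrightarrow> q \<in> Field Q"
  by (rule FieldI1)

text \<open>Monotonicity of forcing. Formulas are arbitrary predicates on conditions, so it has to
  be established connective by connective.\<close>

definition persistent :: "('q \<Rightarrow> bool) \<Rightarrow> bool" where
  "persistent \<phi> \<longleftrightarrow> (\<forall>p q. (q, p) \<in> Q \<longrightarrow> \<phi> p \<longrightarrow> \<phi> q)"

lemma persistentD: "persistent \<phi> \<Longrightarrow> \<phi> p \<Longrightarrow> (q, p) \<in> Q \<Longrightarrow> \<phi> q"
  unfolding persistent_def by blast

lemma persistent_fNot [simp]: "persistent (fNot Q \<phi>)"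
  unfolding persistent_def fNot_def using le_trans by blast

lemma persistent_fAnd [simp]: "persistent \<phi> \<Longrightarrow> persistent \<psi> \<Longrightarrow> persistent (fAnd \<phi> \<psi>)"
  unfolding persistent_def fAnd_def by blast

lemma persistent_fAll [simp]: "(\<And>x. x \<in> A \<Longrightarrow> persistent (\<phi> x)) \<Longrightarrow> persistent (fAll A \<phi>)"
  unfolding persistent_def fAll_def by blast

lemma persistent_fGround [simp]: "persistent (fGround b)"
  unfolding persistent_def fGround_def by blast

lemma persistent_fEx [simp]: "persistent (fEx Q A \<phi>)"
  by (simp add: fEx_def)

lemma persistent_fImp [simp]: "persistent (fImp Q \<phi> \<psi>)"
  by (simp add: fImp_def)

lemma persistent_fMem [simp]: "persistent (fMem Q x A)"
  unfolding persistent_def fMem_def using le_trans by blast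

lemmas fMem_mono = persistentD[OF persistent_fMem]

lemma persistent_fMemF [simp]: "persistent (fMemF Q A U)"
  unfolding persistent_def fMemF_def using le_trans by blast

lemma persistent_fSubset [simp]: "persistent (fSubset Q A B)"
  by (simp add: fSubset_def)

lemma persistent_fFIN_omega [simp]: "persistent (fFIN_omega Q X)"
  by (simp add: fFIN_omega_def fBlockSeq_def fInfinite_def)

lemma persistent_fUltrafilterOn [simp]: "persistent (fUltrafilterOn Q S U)"
  by (simp add: fUltrafilterOn_def)

section \<open>Connectives and quantifiers\<close>

lemma fAnd_iff: "fAnd \<phi> \<psi> p \<longleftrightarrow> \<phi> p \<and> \<psi> p"
  by (simp add: fAnd_def)

lemma fAll_iff: "fAll A \<phi> p \<longleftrightarrow> (\<forall>x\<in>A. \<phi> x p)"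
  by (simp add: fAll_def)

text \<open>Since \<open>fEx\<close> is built from two negations, a witness is available only after
  strengthening the condition.\<close>

lemma fExD:
  "fEx Q A \<phi> p \<Longrightarrow> p \<in> Field Q \<Longrightarrow> \<exists>q. (q, p) \<in> Q \<and> (\<exists>x\<in>A. \<phi> x q)"
  unfolding fEx_def fAll_def fNot_def using le_refl by blast

lemma fExI:
  "(\<And>q. (q, p) \<in> Q \<Longrightarrow> \<exists>r. (r, q) \<in> Q \<and> (\<exists>x\<in>A. \<phi> x r)) \<Longrightarrow> fEx Q A \<phi> p"
  unfolding fEx_def fAll_def fNot_def by blast

lemma fExI_persistent:
  assumes "x \<in> A" "\<phi> x p" "persistent (\<phi> x)"
  shows "fEx Q A \<phi> p"
  by (rule fExI) (meson assms le_Field le_refl persistentD)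

lemma fImpD:
  "fImp Q \<phi> \<psi> p \<Longrightarrow> \<phi> p \<Longrightarrow> p \<in> Field Q \<Longrightarrow> \<exists>q. (q, p) \<in> Q \<and> \<psi> q"
  unfolding fImp_def fAnd_def fNot_def using le_refl by blast

lemma fImpI:
  "(\<And>q. (q, p) \<in> Q \<Longrightarrow> \<phi> q \<Longrightarrow> \<exists>r. (r, q) \<in> Q \<and> \<psi> r) \<Longrightarrow> fImp Q \<phi> \<psi> p"
  unfolding fImp_def fAnd_def fNot_def by blast

lemma fImp_fGroundD: "fImp Q \<phi> (fGround b) p \<Longrightarrow> \<phi> p \<Longrightarrow> p \<in> Field Q \<Longrightarrow> b"
  using fImpD[of \<phi> "fGround b" p] by (auto simp: fGround_def)

lemma fOrD: "fOr Q \<phi> \<psi> p \<Longrightarrow> p \<in> Field Q \<Longrightarrow> \<exists>q. (q, p) \<in> Q \<and> (\<phi> q \<or> \<psi> q)"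
  unfolding fOr_def fAnd_def fNot_def using le_refl by blast

section \<open>Membership, inclusion and canonical names\<close>

lemma fMemD: "fMem Q x A p \<Longrightarrow> p \<in> Field Q \<Longrightarrow> \<exists>q r. (q, p) \<in> Q \<and> (x, r) \<in> A \<and> (q, r) \<in> Q"
  unfolding fMem_def using le_refl by blast

lemma fMemI: "(x, r) \<in> A \<Longrightarrow> (p, r) \<in> Q \<Longrightarrow> fMem Q x A p"
  unfolding fMem_def using le_refl le_trans le_Field by blast

lemma fMem_dense:
  assumes "\<And>q. (q, p) \<in> Q \<Longrightarrow> \<exists>r. (r, q) \<in> Q \<and> fMem Q x A r"
  shows "fMem Q x A p"
  unfolding fMem_def
proof (intro allI impI)
  fix p' assume "(p', p) \<in> Q"
  then obtain r where r: "(r, p') \<in> Q" "fMem Q x A r" using assms by blast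
  then obtain q r' where q: "(q, r) \<in> Q" "(x, r') \<in> A" "(q, r') \<in> Q"
    using fMemD[OF r(2) le_Field[OF r(1)]] by blast
  then show "\<exists>q r. (q, p') \<in> Q \<and> (x, r) \<in> A \<and> (q, r) \<in> Q"
    using le_trans[OF q(1) r(1)] by blast
qed

lemma fMem_check: "p \<in> Field Q \<Longrightarrow> fMem Q x (check Q A) p \<longleftrightarrow> x \<in> A"
proof
  assume "p \<in> Field Q" "fMem Q x (check Q A) p"
  then show "x \<in> A" using fMemD by (fastforce simp: check_def)
next
  assume "p \<in> Field Q" "x \<in> A"
  then show "fMem Q x (check Q A) p"
    using le_refl by (intro fMemI[of _ p]) (auto simp: check_def)
qed

lemma fMem_fCollectI:
  assumes "x \<in> S" "p \<in> Field Q" "\<phi> x p"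
  shows "fMem Q x (fCollect Q S \<phi>) p"
  using assms le_refl by (intro fMemI[of _ p]) (auto simp: fCollect_def)

lemma fMem_fCollectD:
  assumes "fMem Q x (fCollect Q S \<phi>) p" "p \<in> Field Q" "persistent (\<phi> x)"
  shows "\<exists>q. (q, p) \<in> Q \<and> x \<in> S \<and> \<phi> x q"
proof -
  obtain q r where "(q, p) \<in> Q" "(x, r) \<in> fCollect Q S \<phi>" "(q, r) \<in> Q"
    using fMemD[OF assms(1,2)] by blast
  then show ?thesis using persistentD[OF assms(3)] unfolding fCollect_def by blast
qed

text \<open>The implication yields membership in \<open>B\<close> only densely below
  \<open>p\<close>; \<open>fMem_dense\<close> brings it back to \<open>p\<close> itself.\<close>

lemma fSubsetD:
  assumes "fSubset Q A B p" "fMem Q x A p" "p \<in> Field Q"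
  shows "fMem Q x B p"
proof (rule fMem_dense)
  fix q assume q: "(q, p) \<in> Q"
  have "fImp Q (fMem Q x A) (fMem Q x B) p" using assms(1) by (simp add: fSubset_def fAll_def)
  then show "\<exists>r. (r, q) \<in> Q \<and> fMem Q x B r"
    using fImpD persistentD persistent_fImp persistent_fMem q assms(2) le_Field by metis
qed

lemma fSubsetI:
  assumes "\<And>q x. (q, p) \<in> Q \<Longrightarrow> fMem Q x A q \<Longrightarrow> fMem Q x B q"
  shows "fSubset Q A B p"
  unfolding fSubset_def fAll_def
proof
  fix x
  show "fImp Q (fMem Q x A) (fMem Q x B) p"
    by (rule fImpI) (use assms le_refl le_Field in blast)
qed

text \<open>The finite block sequence witnessing membership ranges over ground model objects, so a
  stronger condition decides it.\<close>

lemma fMem_fFU_D: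
  assumes "fMem Q s (fFU Q X) p" "p \<in> Field Q"
  shows "\<exists>q S. (q, p) \<in> Q \<and> finite S \<and> block_seq S \<and> s = \<Union>S \<and> (\<forall>t\<in>S. fMem Q t X q)"
proof -
  obtain q where q: "(q, p) \<in> Q"
    "fEx Q {X. finite X \<and> block_seq X} (\<lambda>S. fAnd (fSubset Q (check Q S) X) (fGround (s = \<Union>S))) q"
    using fMem_fCollectD[OF assms(1)[unfolded fFU_def] assms(2)] by auto
  obtain r S where r: "(r, q) \<in> Q" "finite S" "block_seq S" "fSubset Q (check Q S) X r" "s = \<Union>S"
    using fExD[OF q(2)] le_Field[OF q(1)] by (auto simp: fAnd_def fGround_def)
  have "fMem Q t X r" if "t \<in> S" for t
    using fSubsetD[OF r(4)] fMem_check[of r t S] le_Field[OF r(1)] that by blast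
  then show ?thesis using r le_trans[OF r(1) q(1)] by blast
qed

lemma fMem_fFU_I:
  assumes "finite S" "block_seq S" "\<And>t. t \<in> S \<Longrightarrow> fMem Q t X p" "p \<in> Field Q"
  shows "fMem Q (\<Union>S) (fFU Q X) p"
  unfolding fFU_def
proof (rule fMem_fCollectI)
  have "S \<noteq> {}" using assms(2) by (simp add: block_seq_def)
  then have "\<Union>S \<in> FU S" using Union_in_FU[OF assms(2)] assms(1) by blast
  then show "\<Union>S \<in> FIN" using FU_subset_FIN by blast
  have "fSubset Q (check Q S) X p"
  proof (rule fSubsetI)
    fix r x assume r: "(r, p) \<in> Q" "fMem Q x (check Q S) r"
    then have "x \<in> S" by (simp add: fMem_check[OF le_Field[OF r(1)]])
    then show "fMem Q x X r" using fMem_mono[OF assms(3) r(1)] by simp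
  qed
  then show "fEx Q {X. finite X \<and> block_seq X}
      (\<lambda>S'. fAnd (fSubset Q (check Q S') X) (fGround (\<Union>S = \<Union>S'))) p"
    using assms(1,2) by (intro fExI_persistent[of S]) (auto simp: fAnd_def[of "fSubset Q _ _"] fGround_def)
qed fact

section \<open>Infinite block sequences in the extension\<close>

lemma fFIN_omega_FIN:
  assumes "fFIN_omega Q X p" "fMem Q s X p" "p \<in> Field Q"
  shows "s \<in> FIN"
  using fSubsetD[of X "check Q FIN" p s] assms fMem_check[of p s FIN]
  by (simp add: fFIN_omega_def fBlockSeq_def fAnd_def)

lemma fFIN_omega_blocks:
  assumes X: "fFIN_omega Q X p" and st: "fMem Q s X p" "fMem Q t X p" and p: "p \<in> Field Q"
  shows "s = t \<or> s <\<^sub>b t \<or> t <\<^sub>b s"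
proof -
  have "fImp Q (fAnd (fMem Q s X) (fMem Q t X)) (fGround (s = t \<or> s <\<^sub>b t \<or> t <\<^sub>b s)) p"
    using X fFIN_omega_FIN[OF X _ p] st
    by (simp add: fFIN_omega_def fBlockSeq_def fAnd_def fAll_def)
  then show ?thesis
    by (rule fImp_fGroundD) (use st p in \<open>simp_all add: fAnd_def\<close>)
qed

text \<open>By induction: were no extension of \<open>q\<close> to put a further element into
  \<open>X\<close>, then \<open>q\<close> would force \<open>X\<close> to equal the finite set
  \<open>S\<close>.\<close>

lemma fFIN_omega_finite_subsets:
  assumes "fFIN_omega Q X p" "p \<in> Field Q"
  shows "\<exists>q S. (q, p) \<in> Q \<and> finite S \<and> card S = n \<and> (\<forall>s\<in>S. fMem Q s X q)"
proof (induction n)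
  case 0
  show ?case using le_refl[OF assms(2)] by (intro exI[of _ p] exI[of _ "{}"]) simp
next
  case (Suc n)
  then obtain q S where q: "(q, p) \<in> Q" "finite S" "card S = n" "\<forall>s\<in>S. fMem Q s X q" by blast
  have "\<exists>r u. (r, q) \<in> Q \<and> u \<notin> S \<and> fMem Q u X r"
  proof (rule ccontr)
    assume none: "\<nexists>r u. (r, q) \<in> Q \<and> u \<notin> S \<and> fMem Q u X r"
    have "fSubset Q X (check Q S) q"
    proof (rule fSubsetI)
      fix r x assume r: "(r, q) \<in> Q" "fMem Q x X r"
      then have "x \<in> S" using none by blast
      then show "fMem Q x (check Q S) r" by (simp add: fMem_check[OF le_Field[OF r(1)]])
    qed
    moreover have "fSubset Q (check Q S) X q"
    proof (rule fSubsetI)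
      fix r x assume r: "(r, q) \<in> Q" "fMem Q x (check Q S) r"
      then have "x \<in> S" by (simp add: fMem_check[OF le_Field[OF r(1)]])
      then show "fMem Q x X r" using q(4) fMem_mono[OF _ r(1), of x X] by simp
    qed
    ultimately have "fEq Q X (check Q S) q" by (simp add: fEq_def fAnd_def)
    then have "fEx Q {F. finite F} (\<lambda>F. fEq Q X (check Q F)) q"
      using q(2) by (intro fExI_persistent[of S]) (simp_all add: fEq_def)
    moreover have "fInfinite Q X p" using assms(1) by (simp add: fFIN_omega_def fAnd_def)
    ultimately show False using q(1) unfolding fInfinite_def fNot_def by blast
  qed
  then obtain r u where r: "(r, q) \<in> Q" "u \<notin> S" "fMem Q u X r" by blast
  have "\<forall>s\<in>insert u S. fMem Q s X r"
    using r(3) q(4) by (auto intro: fMem_mono[OF _ r(1)])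
  moreover have "finite (insert u S)" "card (insert u S) = Suc n" using q(2,3) r(2) by auto
  ultimately show ?case using le_trans[OF r(1) q(1)] by blast
qed

text \<open>Once \<open>Suc n\<close> members are decided, their minima are distinct, so they cannot
  all be below \<open>n\<close>.\<close>

lemma fFIN_omega_unbounded:
  assumes X: "fFIN_omega Q X p" and p: "p \<in> Field Q"
  shows "\<exists>q u. (q, p) \<in> Q \<and> u \<in> FIN \<and> n \<le> Min u \<and> fMem Q u X q"
proof -
  obtain q S where q: "(q, p) \<in> Q" "finite S" "card S = Suc n" "\<forall>s\<in>S. fMem Q s X q"
    using fFIN_omega_finite_subsets[OF assms] by blast
  have X': "fFIN_omega Q X q" using X q(1) persistentD[OF persistent_fFIN_omega] by blast
  note q' = le_Field[OF q(1)]
  have S: "S \<subseteq> FIN" using fFIN_omega_FIN[OF X' _ q'] q(4) by blast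
  have "block_seq S"
    unfolding block_seq_def using S q(3,4) fFIN_omega_blocks[OF X' _ _ q'] by fastforce
  then have "card (Min ` S) = Suc n" using inj_on_Min_block_seq q(3) card_image by metis
  then have "\<not> Min ` S \<subseteq> {..<n}" using card_mono[of "{..<n}" "Min ` S"] by auto
  then obtain u where "u \<in> S" "n \<le> Min u" by (metis image_subsetI lessThan_iff not_less)
  then show ?thesis using q S by blast
qed

text \<open>Bounding is applied to the function taking \<open>n\<close> to the least \<open>m\<close> such that \<open>X\<close>
  has a member contained in \<open>[n, m)\<close>.\<close>

lemma bounding_blocks:
  assumes bd: "omega_omega_bounding Q" and X: "fFIN_omega Q X p" and p: "p \<in> Field Q"
  shows "\<exists>q g. (q, p) \<in> Q \<and> (\<forall>n r. (r, q) \<in> Q \<longrightarrow>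
    (\<exists>r' u. (r', r) \<in> Q \<and> u \<in> FIN \<and> n \<le> Min u \<and> Max u < g n \<and> fMem Q u X r'))"
proof -
  define \<phi> where "\<phi> n m r \<longleftrightarrow> (\<exists>u\<in>FIN. n \<le> Min u \<and> Max u < m \<and> fMem Q u X r)" for n m r
  \<comment> \<open>A condition is recorded with \<open>m\<close> only when no extension of it
    admits a smaller value. This makes the named relation single-valued.\<close>
  define F where "F = {((n, m), r) | n m r.
    r \<in> Field Q \<and> \<phi> n m r \<and> (\<forall>m'<m. \<forall>r'. (r', r) \<in> Q \<longrightarrow> \<not> \<phi> n m' r')}"
  have \<phi>_mono: "\<phi> n m r'" if "\<phi> n m r" "(r', r) \<in> Q" for n m r r'
    using that(1) unfolding \<phi>_def by (auto intro: fMem_mono[OF _ that(2)])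
  have total: "fEx Q UNIV (\<lambda>m. fMem Q (n, m) F) p" for n
  proof (rule fExI)
    fix q assume q: "(q, p) \<in> Q"
    then have "fFIN_omega Q X q" using X persistentD[OF persistent_fFIN_omega] by blast
    then obtain r u where "(r, q) \<in> Q" "u \<in> FIN" "n \<le> Min u" "fMem Q u X r"
      using fFIN_omega_unbounded le_Field[OF q] by blast
    then have ex: "\<exists>m r. (r, q) \<in> Q \<and> \<phi> n m r" unfolding \<phi>_def by blast
    \<comment> \<open>Minimising over all conditions below \<open>q\<close>, rather than at
      \<open>q\<close> alone, makes the minimality of \<open>m\<close> hold throughout the
      conditions below \<open>r\<close>.\<close>
    define m where "m = (LEAST m. \<exists>r. (r, q) \<in> Q \<and> \<phi> n m r)"
    obtain r where r: "(r, q) \<in> Q" "\<phi> n m r" using LeastI_ex[OF ex] unfolding m_def by blast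
    have "\<not> \<phi> n m' r'" if "m' < m" "(r', r) \<in> Q" for m' r'
      using not_less_Least[OF that(1)[unfolded m_def]] le_trans[OF that(2) r(1)] by blast
    then have "((n, m), r) \<in> F" using r le_Field unfolding F_def by blast
    then have "fMem Q (n, m) F r" using fMemI le_refl[OF le_Field[OF r(1)]] by metis
    then show "\<exists>r. (r, q) \<in> Q \<and> (\<exists>m\<in>UNIV. fMem Q (n, m) F r)" using r(1) by blast
  qed
  have FD: "\<phi> n m r'" "\<And>m'. \<phi> n m' r' \<Longrightarrow> m \<le> m'" if "((n, m), r) \<in> F" "(r', r) \<in> Q" for n m r r'
    using that \<phi>_mono unfolding F_def by (auto simp: not_less[symmetric])
  have "fImp Q (fAnd (fMem Q (n, m) F) (fMem Q (n, m') F)) (fGround (m = m')) p" for n m m'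
  proof (rule fImpI)
    fix q assume q: "(q, p) \<in> Q" "fAnd (fMem Q (n, m) F) (fMem Q (n, m') F) q"
    then have q': "fMem Q (n, m) F q" "fMem Q (n, m') F q" by (simp_all add: fAnd_iff)
    then obtain r r1 where r: "(r, q) \<in> Q" "((n, m), r1) \<in> F" "(r, r1) \<in> Q"
      using fMemD[OF q'(1) le_Field[OF q(1)]] by blast
    obtain r' r2 where r': "(r', r) \<in> Q" "((n, m'), r2) \<in> F" "(r', r2) \<in> Q"
      using fMemD[OF fMem_mono[OF q'(2) r(1)] le_Field[OF r(1)]] by blast
    \<comment> \<open>Now \<open>r'\<close> is below both recorded conditions, so \<open>m\<close>
      and \<open>m'\<close> are each minimal there.\<close>
    have "(r', r1) \<in> Q" using le_trans[OF r'(1) r(3)] .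
    then have "m = m'" using FD[OF r(2)] FD[OF r'(2,3)] by (meson le_antisym)
    then show "\<exists>r. (r, q) \<in> Q \<and> fGround (m = m') r" using r(1) by (auto simp: fGround_def)
  qed
  then have "fFunction Q F p" using total by (simp add: fFunction_def fAnd_iff fAll_iff)
  moreover have "fImp Q (fFunction Q F) (fEx Q UNIV (\<lambda>g.
      fAll UNIV (\<lambda>n. fAll UNIV (\<lambda>m. fImp Q (fMem Q (n, m) F) (fGround (m \<le> g n)))))) p"
    using bd p by (simp add: omega_omega_bounding_def forced_def fAll_iff)
  ultimately obtain q1 where q1: "(q1, p) \<in> Q" "fEx Q UNIV (\<lambda>g.
      fAll UNIV (\<lambda>n. fAll UNIV (\<lambda>m. fImp Q (fMem Q (n, m) F) (fGround (m \<le> g n))))) q1"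
    using fImpD p by blast
  then obtain q g where q: "(q, q1) \<in> Q"
    "\<And>n m. fImp Q (fMem Q (n, m) F) (fGround (m \<le> g n)) q"
    using fExD[OF q1(2) le_Field[OF q1(1)]] unfolding fAll_def by blast
  have qp: "(q, p) \<in> Q" using q q1 le_trans by blast
  have "\<exists>r' u. (r', r) \<in> Q \<and> u \<in> FIN \<and> n \<le> Min u \<and> Max u < g n \<and> fMem Q u X r'"
    if r: "(r, q) \<in> Q" for n r
  proof -
    have "fEx Q UNIV (\<lambda>m. fMem Q (n, m) F) r"
      using total persistentD[OF persistent_fEx] le_trans[OF r qp] by blast
    then obtain r1 m where r1: "(r1, r) \<in> Q" "fMem Q (n, m) F r1"
      using fExD le_Field[OF r] by blast
    have "fImp Q (fMem Q (n, m) F) (fGround (m \<le> g n)) r1"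
      using q(2) persistentD[OF persistent_fImp] le_trans[OF r1(1) r] by blast
    then have "m \<le> g n" using r1 fImp_fGroundD le_Field by blast
    moreover obtain r2 r3 where r2: "(r2, r1) \<in> Q" "((n, m), r3) \<in> F" "(r2, r3) \<in> Q"
      using fMemD[OF r1(2) le_Field[OF r1(1)]] by blast
    then have "\<phi> n m r2" using FD(1) by blast
    ultimately show ?thesis using le_trans[OF r2(1) r1(1)] unfolding \<phi>_def
      by (meson less_le_trans)
  qed
  then show ?thesis using qp by blast
qed

text \<open>Otherwise some extension would force the intersection, a member of \<open>U\<close>, to
  be included in the empty set, and upward closure would put the empty set into
  \<open>U\<close>.\<close>

lemma fUltrafilterOn_meet:
  assumes uf: "fUltrafilterOn Q S U p" and p: "p \<in> Field Q"
    and AB: "fMemF Q A U p" "fMemF Q B U p"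
  shows "\<exists>q x. (q, p) \<in> Q \<and> x \<in> S \<and> fMem Q x A q \<and> fMem Q x B q"
proof (rule ccontr)
  assume none: "\<not> ?thesis"
  let ?D = "fCollect Q S (\<lambda>x. fAnd (fMem Q x A) (fMem Q x B))"
  have "fImp Q (fAnd (fMemF Q A U) (fMemF Q B U)) (fMemF Q ?D U) p"
    using uf by (simp add: fUltrafilterOn_def fAnd_iff fAll_iff)
  then obtain q where q: "(q, p) \<in> Q" "fMemF Q ?D U q"
    using fImpD[of _ _ p] AB p unfolding fAnd_def by blast
  note q' = le_Field[OF q(1)]
  have "fSubset Q ?D (check Q {}) q"
  proof (rule fSubsetI)
    fix r x assume r: "(r, q) \<in> Q" "fMem Q x ?D r"
    then obtain r' where r': "(r', r) \<in> Q" "x \<in> S" "fAnd (fMem Q x A) (fMem Q x B) r'"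
      using fMem_fCollectD[OF r(2) le_Field[OF r(1)]] by auto
    then have "(r', p) \<in> Q" using le_trans r(1) q(1) by blast
    then show "fMem Q x (check Q {}) r" using none r' unfolding fAnd_def by blast
  qed
  moreover have "fSubset Q (check Q {}) (check Q S) q"
    by (rule fSubsetI) (simp add: fMem_check[OF le_Field])
  moreover have "fUltrafilterOn Q S U q" using uf q(1) persistentD[OF persistent_fUltrafilterOn] by blast
  then have "fImp Q (fAnd (fMemF Q ?D U) (fAnd (fSubset Q ?D (check Q {})) (fSubset Q (check Q {}) (check Q S))))
      (fMemF Q (check Q {}) U) q"
    and empty: "fNot Q (fMemF Q (check Q {}) U) q"
    by (simp_all add: fUltrafilterOn_def fAnd_iff fAll_iff)
  ultimately obtain r where "(r, q) \<in> Q" "fMemF Q (check Q {}) U r"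
    using fImpD[of _ _ q] q(2) q' unfolding fAnd_def by blast
  then show False using empty unfolding fNot_def by blast
qed

end

section \<open>The generic colouring\<close>

definition decides :: "(nat set \<Rightarrow> bool) list set \<Rightarrow> nat set \<Rightarrow> bool" where
  "decides p s \<longleftrightarrow> (\<forall>f\<in>p. Max s < length f \<longrightarrow> (f ! Max s) (s - {Max s}))"

text \<open>The name for \<open>{s. x(max s)(s\<^sup>-)}\<close>, where \<open>x\<close> is the generic branch given by \<open>e\<close>.\<close>

definition generic_colour :: "nat set set set \<Rightarrow> ((nat set \<Rightarrow> bool) list set \<Rightarrow> 'q) \<Rightarrow>
    (nat set, 'q) set_name" where
  "generic_colour H e = {(s, e p) | s p. s \<in> FIN \<and> p \<in> H_conditions H \<and> decides p s}"

text \<open>As \<open>u\<close> sits in the gap in front of the last block \<open>t\<close> of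
  \<open>s\<close>, adding it leaves the maximum unchanged. Both colours are therefore read off the
  same value of the branch, to which the flip demand for \<open>t\<close> applies.\<close>

lemma thin_flips:
  assumes Y: "block_seq Y" and gap: "\<And>t. t \<in> Y \<Longrightarrow> g (pred_bound Y t) < Min t"
    and t: "t \<in> Y" and b: "b \<subseteq> {..<pred_bound Y t}" and s: "s = b \<union> t" "Max s = Max t"
    and u: "u \<in> FIN" "pred_bound Y t \<le> Min u" "Max u < g (pred_bound Y t)"
  shows "Max (u \<union> s) = Max s"
    and "f \<in> thin p g Y \<Longrightarrow> Max s < length f \<Longrightarrow>
      (f ! Max s) (u \<union> s - {Max s}) \<noteq> (f ! Max s) (s - {Max s})"
proof -
  have tF: "t \<in> FIN" using block_seq_FIN[OF Y t] .
  have fin: "finite u" "u \<noteq> {}" "finite s" "s \<noteq> {}"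
    using u(1) tF s(1) b finite_subset[OF b] by (auto simp: FIN_def)
  have ut: "Max u < Max t" using u(3) gap[OF t] Min_le_Max_FIN[OF tF] by linarith
  have bt: "Max t \<notin> b"
  proof
    assume "Max t \<in> b"
    then have "Max t < pred_bound Y t" using b by blast
    then show False using u(2,3) Min_le_Max_FIN[OF u(1)] gap[OF t] Min_le_Max_FIN[OF tF] by linarith
  qed
  have mu: "Max t \<notin> u" using ut Max_ge[OF fin(1), of "Max t"] by auto
  show "Max (u \<union> s) = Max s" using fin ut s(2) by (simp add: Max_Un)
  have eq: "s - {Max s} = b \<union> (t - {Max t})" "u \<union> s - {Max s} = b \<union> u \<union> (t - {Max t})"
    using s bt mu by auto
  have ui: "u \<subseteq> {pred_bound Y t..<g (pred_bound Y t)}"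
  proof
    fix a assume "a \<in> u"
    then show "a \<in> {pred_bound Y t..<g (pred_bound Y t)}"
      using Min_le[OF fin(1), of a] Max_ge[OF fin(1), of a] u(2,3) by simp
  qed
  show "(f ! Max s) (u \<union> s - {Max s}) \<noteq> (f ! Max s) (s - {Max s})"
    if f: "f \<in> thin p g Y" "Max s < length f"
  proof -
    have "flips (pred_bound Y t) (g (pred_bound Y t)) t (f ! Max t)"
      using f t s(2) unfolding thin_def by simp
    then have "(f ! Max t) (b \<union> u \<union> (t - {Max t})) \<noteq> (f ! Max t) (b \<union> (t - {Max t}))"
      using b ui fin(2) unfolding flips_def by blast
    then show ?thesis by (simp only: eq s(2)[symmetric]) (use s(2) eq in simp)
  qed
qed

lemma restrict_to_nth:
  assumes "g \<in> restrict_to p f" "n < length f" "n < length g"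
  shows "g ! n = f ! n"
  using assms unfolding restrict_to_def by (auto elim!: prefixE simp: nth_append)

locale generic = forcing Q for Q :: "'q rel" +
  fixes H :: "nat set set set" and e :: "(nat set \<Rightarrow> bool) list set \<Rightarrow> 'q"
  assumes H: "stable_ordered_union_ultrafilter H"
    and emb: "complete_embedding (PH H) Q e"
begin

lemma uf: "ultrafilter_on FIN H"
  using H by (simp add: stable_ordered_union_ultrafilter_def)

lemma Field_PH: "Field (PH H) = H_conditions H"
  by (auto simp: PH_def Field_def)

lemma compatible_emb:
  "p \<in> H_conditions H \<Longrightarrow> p' \<in> H_conditions H \<Longrightarrow> (r, e p) \<in> Q \<Longrightarrow> (r, e p') \<in> Q \<Longrightarrow>
    \<exists>q\<in>H_conditions H. q \<subseteq> p \<and> q \<subseteq> p'"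
proof -
  assume *: "p \<in> H_conditions H" "p' \<in> H_conditions H" "(r, e p) \<in> Q" "(r, e p') \<in> Q"
  then have "compatible Q (e p) (e p')" unfolding compatible_def by blast
  then have "compatible (PH H) p p'"
    using emb * unfolding complete_embedding_def Field_PH by blast
  then show ?thesis unfolding compatible_def PH_def by blast
qed

text \<open>Such a \<open>p\<close> is a reduction of \<open>r\<close>; it is supplied by the last
  clause of \<open>complete_embedding\<close>.\<close>

lemma reduction:
  assumes "r \<in> Field Q"
  shows "\<exists>p\<in>H_conditions H. \<forall>p'\<in>H_conditions H. p' \<subseteq> p \<longrightarrow> (\<exists>r'. (r', e p') \<in> Q \<and> (r', r) \<in> Q)"
proof -
  obtain p where p: "p \<in> H_conditions H" "\<forall>p'. (p', p) \<in> PH H \<longrightarrow> compatible Q (e p') r"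
    using emb assms unfolding complete_embedding_def Field_PH by blast
  show ?thesis
  proof (rule bexI[OF _ p(1)], intro ballI impI)
    fix p' assume "p' \<in> H_conditions H" "p' \<subseteq> p"
    then have "(p', p) \<in> PH H" using p(1) by (simp add: PH_def)
    then show "\<exists>r'. (r', e p') \<in> Q \<and> (r', r) \<in> Q" using p(2) unfolding compatible_def by blast
  qed
qed

text \<open>Membership would put some extension of \<open>r\<close> below \<open>e p1\<close> with
  \<open>decides p1 s\<close>. A common extension of \<open>p1\<close> and the restricted tree then
  has a node long enough to carry contradictory values at \<open>Max s\<close>.\<close>

lemma colour_persists:
  assumes p: "p \<in> H_conditions H" and f: "f \<in> p" "Max s < length f"
    and np: "\<not> (f ! Max s) (s - {Max s})"
    and r: "(r, e (restrict_to p f)) \<in> Q"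
  shows "\<not> fMem Q s (generic_colour H e) r"
proof
  let ?p = "restrict_to p f"
  assume mem: "fMem Q s (generic_colour H e) r"
  obtain r' r1 where "(r', r) \<in> Q" "(s, r1) \<in> generic_colour H e" "(r', r1) \<in> Q"
    using fMemD[OF mem le_Field[OF r]] by blast
  then obtain p1 where p1: "(r', r) \<in> Q" "p1 \<in> H_conditions H" "decides p1 s" "(r', e p1) \<in> Q"
    unfolding generic_colour_def by blast
  have "?p \<in> H_conditions H" using restrict_to_condition[OF uf p f(1)] .
  then obtain q where q: "q \<in> H_conditions H" "q \<subseteq> ?p" "q \<subseteq> p1"
    using compatible_emb[OF _ p1(2) le_trans[OF p1(1) r] p1(4)] by blast
  obtain g where g: "g \<in> q" "length g = Suc (Max s)"
    using H_conditions_extend[OF q(1) H_conditionsD(3)[OF q(1)], of "Suc (Max s)"] by auto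
  have "g ! Max s = f ! Max s" using restrict_to_nth[of g p f "Max s"] g q(2) f(2) by auto
  moreover have "(g ! Max s) (s - {Max s})" using p1(3) g q(3) unfolding decides_def by auto
  ultimately show False using np by simp
qed

text \<open>All sufficiently long nodes of the restricted tree agree with \<open>f\<close> at
  \<open>Max s\<close>, so this tree is itself recorded in the name.\<close>

lemma colour_decided:
  assumes p: "p \<in> H_conditions H" and s: "s \<in> FIN" and f: "f \<in> p" "Max s < length f"
    and yes: "(f ! Max s) (s - {Max s})"
    and r: "(r, e (restrict_to p f)) \<in> Q"
  shows "fMem Q s (generic_colour H e) r"
proof (rule fMemI[OF _ r])
  have "decides (restrict_to p f) s"
    unfolding decides_def using restrict_to_nth f(2) yes by metis
  then show "(s, e (restrict_to p f)) \<in> generic_colour H e"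
    using s restrict_to_condition[OF uf p f(1)] unfolding generic_colour_def by blast
qed

lemma not_forced:
  assumes bd: "omega_omega_bounding Q" and q0: "q0 \<in> Field Q"
    and U: "fStableOrderedUnionUltrafilter Q U q0" and ext: "fExtends Q U H q0"
  shows False
proof -
  let ?C = "generic_colour H e"
  let ?C' = "fCollect Q FIN (\<lambda>x. fNot Q (fMem Q x ?C))"
  have fuf: "fUltrafilterOn Q FIN U q0" and fou: "fOrderedUnion Q U q0"
    using U by (simp_all add: fStableOrderedUnionUltrafilter_def fAnd_iff)
  have "fSubset Q ?C (check Q FIN) q0"
  proof (rule fSubsetI)
    fix q x assume q: "(q, q0) \<in> Q" "fMem Q x ?C q"
    obtain r where "(x, r) \<in> ?C" using fMemD[OF q(2) le_Field[OF q(1)]] by blast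
    then have "x \<in> FIN" by (auto simp: generic_colour_def)
    then show "fMem Q x (check Q FIN) q" by (simp add: fMem_check[OF le_Field[OF q(1)]])
  qed
  moreover have "fImp Q (fSubset Q ?C (check Q FIN)) (fOr Q (fMemF Q ?C U) (fMemF Q ?C' U)) q0"
    using fuf by (simp add: fUltrafilterOn_def fAnd_iff fAll_iff)
  ultimately obtain q' where q': "(q', q0) \<in> Q" "fOr Q (fMemF Q ?C U) (fMemF Q ?C' U) q'"
    using fImpD[OF _ _ q0] by blast
  then obtain q1 A where q1: "(q1, q') \<in> Q" "fMemF Q A U q1" "A = ?C \<or> A = ?C'"
    using fOrD[OF q'(2) le_Field[OF q'(1)]] by blast
  have q10: "(q1, q0) \<in> Q" using le_trans[OF q1(1) q'(1)] .
  have imp: "fImp Q (fMemF Q A U)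
      (fEx Q UNIV (\<lambda>X. fAnd (fFIN_omega Q X) (fAnd (fMemF Q (fFU Q X) U) (fSubset Q (fFU Q X) A)))) q1"
    using fou by (intro persistentD[OF persistent_fImp _ q10]) (simp add: fOrderedUnion_def fAll_iff)
  obtain q'' where q'': "(q'', q1) \<in> Q"
      "fEx Q UNIV (\<lambda>X. fAnd (fFIN_omega Q X) (fAnd (fMemF Q (fFU Q X) U) (fSubset Q (fFU Q X) A))) q''"
    using fImpD[OF imp, OF q1(2) le_Field[OF q1(1)]] by blast
  then obtain q2 X where q2: "(q2, q'') \<in> Q" "fFIN_omega Q X q2" "fMemF Q (fFU Q X) U q2"
      "fSubset Q (fFU Q X) A q2"
    using fExD[OF q''(2) le_Field[OF q''(1)]] by (auto simp: fAnd_iff)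
  have q20: "(q2, q0) \<in> Q" using le_trans[OF le_trans[OF q2(1) q''(1)] q10] .
  obtain q3 g' where q3: "(q3, q2) \<in> Q"
    and g': "\<And>n r. (r, q3) \<in> Q \<Longrightarrow>
      \<exists>r' u. (r', r) \<in> Q \<and> u \<in> FIN \<and> n \<le> Min u \<and> Max u < g' n \<and> fMem Q u X r'"
    using bounding_blocks[OF bd q2(2) le_Field[OF q2(1)]] by blast
  \<comment> \<open>Taking the maximum with \<open>n\<close> gives \<open>n \<le> g n\<close>, which
    the thinning requires; enlarging the bound keeps the blocks found below it.\<close>
  define g where "g n = max n (g' n)" for n
  have gn: "\<And>n. n \<le> g n" by (simp add: g_def)
  \<comment> \<open>The thinning is carried out below a reduction of \<open>q3\<close>, so that the
    image of the thinned condition stays compatible with \<open>q3\<close>.\<close>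
  obtain p where p: "p \<in> H_conditions H"
    "\<And>p'. p' \<in> H_conditions H \<Longrightarrow> p' \<subseteq> p \<Longrightarrow> \<exists>r. (r, e p') \<in> Q \<and> (r, q3) \<in> Q"
    using reduction[OF le_Field[OF q3]] by blast
  obtain Y where Y: "Y \<in> FIN_omega" "FU Y \<in> H"
    and Ybig: "\<And>t. t \<in> Y \<Longrightarrow> t \<in> big_heights p (g (pred_bound Y t))"
    and Ygap: "\<And>t. t \<in> Y \<Longrightarrow> g (pred_bound Y t) < Min t"
    using stable_diagonal[OF H, of "big_heights p" g] H_conditionsD(5)[OF p(1)] by blast
  have bY: "block_seq Y" using FIN_omega_block_seq[OF Y(1)] .
  define q where "q = thin p g Y"
  have q: "q \<in> H_conditions H"
    unfolding q_def using thin_condition[OF H p(1) gn Y Ybig Ygap] .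
  have "q \<subseteq> p" by (auto simp: q_def thin_def)
  then obtain r where r: "(r, e q) \<in> Q" "(r, q3) \<in> Q" using p(2)[OF q] by blast
  have r2: "(r, q2) \<in> Q" using le_trans[OF r(2) q3] .
  have r0: "(r, q0) \<in> Q" using le_trans[OF r2 q20] .
  have "fMemF Q (check Q (FU Y)) U q0" using ext Y(2) by (simp add: fExtends_def fAll_iff)
  then have "fMemF Q (check Q (FU Y)) U r" using persistentD[OF persistent_fMemF _ r0] by blast
  moreover have "fMemF Q (fFU Q X) U r" using persistentD[OF persistent_fMemF q2(3) r2] .
  moreover have "fUltrafilterOn Q FIN U r" using persistentD[OF persistent_fUltrafilterOn fuf r0] .
  ultimately obtain r1 s where r1: "(r1, r) \<in> Q" "fMem Q s (fFU Q X) r1"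
    "fMem Q s (check Q (FU Y)) r1"
    using fUltrafilterOn_meet[OF _ le_Field[OF r(1)]] by blast
  have sY: "s \<in> FU Y" using r1(3) by (simp add: fMem_check[OF le_Field[OF r1(1)]])
  obtain t b where t: "t \<in> Y" "b \<subseteq> {..<pred_bound Y t}" "s = b \<union> t" "Max s = Max t"
    using FU_decompose[OF bY sY] .
  obtain r3 S where r3: "(r3, r1) \<in> Q" "finite S" "block_seq S" "s = \<Union>S" "\<forall>x\<in>S. fMem Q x X r3"
    using fMem_fFU_D[OF r1(2) le_Field[OF r1(1)]] by blast
  have r33: "(r3, q3) \<in> Q" using le_trans[OF le_trans[OF r3(1) r1(1)] r(2)] .
  \<comment> \<open>Bounding is used at the start of the gap in front of the last block of
    \<open>s\<close>, which is known only now; the thinning provided for every block of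
    \<open>Y\<close>.\<close>
  obtain r4 u where r4: "(r4, r3) \<in> Q" "u \<in> FIN" "pred_bound Y t \<le> Min u"
      "Max u < g' (pred_bound Y t)" "fMem Q u X r4"
    using g'[OF r33] by blast
  have ug: "Max u < g (pred_bound Y t)" using r4(4) by (simp add: g_def)
  note r4F = le_Field[OF r4(1)]
  have r4r: "(r4, r) \<in> Q" using le_trans[OF r4(1) le_trans[OF r3(1) r1(1)]] .
  have r4q: "(r4, e q) \<in> Q" using le_trans[OF r4r r(1)] .
  have r42: "(r4, q2) \<in> Q" using le_trans[OF r4r r2] .
  have X4: "fFIN_omega Q X r4" using persistentD[OF persistent_fFIN_omega q2(2) r42] .
  have uS: "fMem Q x X r4" if "x \<in> insert u S" for x
    using that r4(5) r3(5) by (auto intro: fMem_mono[OF _ r4(1)])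
  have "block_seq (insert u S)"
    unfolding block_seq_def
  proof (intro conjI ballI)
    show "insert u S \<subseteq> FIN" using fFIN_omega_FIN[OF X4 uS r4F] by blast
    fix x y assume "x \<in> insert u S" "y \<in> insert u S"
    then show "x = y \<or> x <\<^sub>b y \<or> y <\<^sub>b x" using fFIN_omega_blocks[OF X4 uS uS r4F] by blast
  qed simp
  then have us4: "fMem Q (u \<union> s) (fFU Q X) r4"
    using fMem_fFU_I[of "insert u S" X r4] uS r3(2,4) r4F by simp
  have s4: "fMem Q s (fFU Q X) r4"
    using fMem_mono[OF r1(2) le_trans[OF r4(1) r3(1)]] .
  have homog: "fMem Q x A r'" if "x = s \<or> x = u \<union> s" "(r', r4) \<in> Q" for x r'
  proof -
    have "fMem Q x (fFU Q X) r4" using that(1) us4 s4 by blast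
    then have "fMem Q x A r4"
      by (rule fSubsetD[OF persistentD[OF persistent_fSubset q2(4) r42] _ r4F])
    then show ?thesis by (rule fMem_mono[OF _ that(2)])
  qed
  \<comment> \<open>To read off colours, a node is needed whose restricted condition is compatible
    with \<open>r4\<close>. Hence a reduction \<open>p2\<close> of \<open>r4\<close> is taken and
    then refined to \<open>p3\<close> inside the thinned tree \<open>q\<close>.\<close>
  obtain p2 where p2: "p2 \<in> H_conditions H"
    "\<And>p'. p' \<in> H_conditions H \<Longrightarrow> p' \<subseteq> p2 \<Longrightarrow> \<exists>r'. (r', e p') \<in> Q \<and> (r', r4) \<in> Q"
    using reduction[OF r4F] by blast
  obtain r5 where r5: "(r5, e p2) \<in> Q" "(r5, r4) \<in> Q" using p2(2)[OF p2(1)] by blast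
  obtain p3 where p3: "p3 \<in> H_conditions H" "p3 \<subseteq> p2" "p3 \<subseteq> q"
    using compatible_emb[OF p2(1) q r5(1) le_trans[OF r5(2) r4q]] by blast
  \<comment> \<open>Length \<open>Suc (Max s)\<close> is just enough for \<open>f\<close> to fix the
    value at height \<open>Max s\<close>.\<close>
  obtain f where f: "f \<in> p3" "length f = Suc (Max s)"
    using H_conditions_extend[OF p3(1) H_conditionsD(3)[OF p3(1)], of "Suc (Max s)"] by auto
  let ?p4 = "restrict_to p3 f"
  have "?p4 \<in> H_conditions H" "?p4 \<subseteq> p2"
    using restrict_to_condition[OF uf p3(1) f(1)] p3(2) by (auto simp: restrict_to_def)
  then obtain r6 where r6: "(r6, e ?p4) \<in> Q" "(r6, r4) \<in> Q" using p2(2) by blast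
  have mus: "Max (u \<union> s) = Max s"
    using thin_flips(1)[OF bY Ygap t r4(2,3) ug] .
  have "f \<in> thin p g Y" using f(1) p3(3) unfolding q_def by blast
  then have flip: "(f ! Max s) (u \<union> s - {Max s}) \<noteq> (f ! Max s) (s - {Max s})"
    using thin_flips(2)[OF bY Ygap t r4(2,3) ug] f(2) by simp
  have sF: "s \<in> FIN" "u \<union> s \<in> FIN"
    using sY FU_subset_FIN r4(2) by (auto simp: FIN_def)
  show False
  proof (cases "A = ?C")
    case True
    \<comment> \<open>Of \<open>s\<close> and its union with \<open>u\<close>, exactly one gets the
      value false at \<open>f\<close>. It is forced out of the colour class, although both are
      forced into \<open>A\<close>.\<close>
    obtain x where x: "x = s \<or> x = u \<union> s" "\<not> (f ! Max s) (x - {Max s})" using flip by blast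
    then have mx: "Max x = Max s" using mus by blast
    have "\<not> fMem Q x ?C r6"
      using colour_persists[OF p3(1) f(1) _ _ r6(1), of x] f(2) x(2) by (simp add: mx)
    then show False using homog[OF x(1) r6(2)] True by simp
  next
    case False
    then have A: "A = ?C'" using q1(3) by blast
    obtain x where x: "x = s \<or> x = u \<union> s" "(f ! Max s) (x - {Max s})" using flip by blast
    then have mx: "Max x = Max s" "x \<in> FIN" using mus sF by blast+
    have yes: "fMem Q x ?C r6"
      using colour_decided[OF p3(1) mx(2) f(1) _ _ r6(1)] f(2) x(2) by (simp add: mx)
    obtain r7 where r7: "(r7, r6) \<in> Q" "fNot Q (fMem Q x ?C) r7"
      using fMem_fCollectD[OF homog[OF x(1) r6(2), unfolded A] le_Field[OF r6(1)]] by auto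
    have "fMem Q x ?C r7" using fMem_mono[OF yes r7(1)] .
    then show False using r7(2) le_refl[OF le_Field[OF r7(1)]] unfolding fNot_def by blast
  qed
qed

end

theorem theorem5p7:
  fixes H :: "nat set set set" and Q :: "'q rel"
  assumes "stable_ordered_union_ultrafilter H"
    and "forcing_notion Q"
    and "omega_omega_bounding Q"
    and "completely_embeds (PH H) Q"
  shows "forced Q (fNot Q (fEx Q UNIV (\<lambda>U :: (nat set, 'q) family_name.
           fAnd (fStableOrderedUnionUltrafilter Q U) (fExtends Q U H))))"
proof -
  obtain e where "complete_embedding (PH H) Q e"
    using assms(4) by (auto simp: completely_embeds_def)
  then interpret generic Q H e
    using assms(1,2) by unfold_locales
  show ?thesis
    unfolding forced_def fNot_def[of Q "fEx Q _ _"]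
  proof (intro ballI allI impI notI)
    fix p q
    assume q: "(q, p) \<in> Q" and ex: "fEx Q UNIV (\<lambda>U :: (nat set, 'q) family_name.
      fAnd (fStableOrderedUnionUltrafilter Q U) (fExtends Q U H)) q"
    obtain r and U :: "(nat set, 'q) family_name" where "(r, q) \<in> Q"
        "fStableOrderedUnionUltrafilter Q U r" "fExtends Q U H r"
      using fExD[OF ex le_Field[OF q]] by (auto simp: fAnd_iff)
    then show False using not_forced[OF assms(3) le_Field] by blast
  qed
qed

end
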